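(* The $\mathbb{Z}[h,t]$-module $R_n^{h,t}$ has rank $\sum_{0\le k\le n}\frac{2k+1}{n+k+1}\binom{2n}{n+k}$ over $\mathbb{Z}[h,t]$, and $B_n$ forms a basis of it.
   Context: $R^{h,t}_n$ is the quotient of the free $\mathbb{Z}[h,t]$-module on crossingless matchings of the points $1,\ldots,2n$ whose arcs carry any finite number of dots by the following local relations. Dot reduction: an arc with two dots equals $h$ times the arc with one dot plus $t$ times the arc with none (all other dots unchanged). For $a<b<c<d$, with a bar marking one dot: Type I: $[\overline{ab},cd]+[ab,\overline{cd}]-h[ab,cd]=[\overline{ad},bc]+[ad,\overline{bc}]-h[ad,bc]$. Type II: $[\overline{ab},\overline{cd}]+t[ab,cd]=[\overline{ad},\overline{bc}]+t[ad,bc]$. In each relation the diagrams are identical away from the arcs shown, and extra dots are allowed on the segments of these arcs near the endpoints $a,b,c,d$, the same number near a given endpoint in all terms. An arc $(p,p')$ is outer if no arc $(e,e')$ satisfies $e<p$ and $p'<e'$. $B_{n,k}$ is the set of diagrams with exactly $k$ dots in total, all on outer arcs, each arc carrying at most one dot, and $B_n=\bigcup_{0\le k\le n}B_{n,k}$. *)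

theory Defs
  imports
    "HOL-Library.Poly_Mapping"
    "HOL-Algebra.AbelCoset"
    "HOL-Algebra.Algebraic_Closure_Type"
    "Jordan_Normal_Form.Missing_VectorSpace"
begin

section \<open>Free modules, quotient modules, bases and rank\<close>

text \<open>As for \<^const>\<open>ring.func_space\<close>, the ring fields \<^const>\<open>monoid.mult\<close> and \<^const>\<open>one\<close> of a
  module record are irrelevant and filled with dummy values.\<close>

definition free_module :: "'d set \<Rightarrow> ('r::comm_ring_1, 'd \<Rightarrow>\<^sub>0 'r) module" where
  "free_module S =
     \<lparr>carrier = {f. Poly_Mapping.keys f \<subseteq> S}, monoid.mult = (\<lambda>_ _. 0), one = 0, ring.zero = 0,
      add = (+), module.smult = (\<lambda>c. Poly_Mapping.map ((*) c))\<rparr>"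

definition quotient_module :: "('r, 'a, 'm) module_scheme \<Rightarrow> 'a set \<Rightarrow> ('r, 'a set) module" where
  "quotient_module M N =
     \<lparr>carrier = a_rcosets\<^bsub>M\<^esub> N, monoid.mult = (\<lambda>_ _. N), one = N, ring.zero = N,
      add = set_add M, module.smult = (\<lambda>r C. \<Union>x\<in>C. N +>\<^bsub>M\<^esub> (r \<odot>\<^bsub>M\<^esub> x))\<rparr>"

definition module_basis :: "('r, 'k) ring_scheme \<Rightarrow> ('r, 'a, 'm) module_scheme \<Rightarrow> 'a set \<Rightarrow> bool" where
  "module_basis R M B \<longleftrightarrow>
     B \<subseteq> carrier M \<and> \<not> LinearCombinations.module.lin_dep R M B \<and>
     LinearCombinations.module.span R M B = carrier M"

text \<open>The common cardinality of all (finite) bases of a free module.\<close>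

definition free_rank :: "('r, 'k) ring_scheme \<Rightarrow> ('r, 'a, 'm) module_scheme \<Rightarrow> nat" where
  "free_rank R M = (THE r. \<exists>B. module_basis R M B \<and> finite B \<and> card B = r)"

lemma free_module_simps [simp]:
  "carrier (free_module S) = {f. Poly_Mapping.keys f \<subseteq> S}"
  "ring.zero (free_module S) = 0"
  "add (free_module S) = (+)"
  "module.smult (free_module S) = (\<lambda>c. Poly_Mapping.map ((*) c))"
  by (simp_all add: free_module_def)

lemma lookup_map_times:
  "Poly_Mapping.lookup (Poly_Mapping.map ((*) c) f) k = c * Poly_Mapping.lookup f k"
  for c :: "'r::comm_ring_1"
  by (simp add: Poly_Mapping.map.rep_eq when_def)

lemma module_free_module:
  fixes S :: "'d set"
  shows "Module.module (ring_of_type_algebra :: 'r::comm_ring_1 ring) (free_module S)"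
proof (rule moduleI)
  show "cring (ring_of_type_algebra :: 'r ring)" by (rule cring_from_type_algebra)
  show "abelian_group (free_module S :: ('r, 'd \<Rightarrow>\<^sub>0 'r) module)"
  proof (rule abelian_groupI)
    fix x y :: "'d \<Rightarrow>\<^sub>0 'r"
    assume "x \<in> carrier (free_module S)" "y \<in> carrier (free_module S)"
    then show "x \<oplus>\<^bsub>free_module S\<^esub> y \<in> carrier (free_module S)"
      using Poly_Mapping.keys_add[of x y] by auto
  next
    fix x :: "'d \<Rightarrow>\<^sub>0 'r"
    assume "x \<in> carrier (free_module S)"
    then show "\<exists>y\<in>carrier (free_module S). y \<oplus>\<^bsub>free_module S\<^esub> x = \<zero>\<^bsub>free_module S\<^esub>"
      by (intro bexI[of _ "- x"]) auto
  qed (auto simp: add_ac)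
  show "a \<odot>\<^bsub>free_module S\<^esub> x \<in> carrier (free_module S)"
    if "x \<in> carrier (free_module S)" for a :: 'r and x :: "'d \<Rightarrow>\<^sub>0 'r"
  proof -
    have "Poly_Mapping.keys (Poly_Mapping.map ((*) a) x) \<subseteq> Poly_Mapping.keys x"
    proof
      fix k assume "k \<in> Poly_Mapping.keys (Poly_Mapping.map ((*) a) x)"
      then have "a * Poly_Mapping.lookup x k \<noteq> 0" by (simp add: in_keys_iff lookup_map_times)
      then have "Poly_Mapping.lookup x k \<noteq> 0" by (cases "Poly_Mapping.lookup x k = 0") simp_all
      then show "k \<in> Poly_Mapping.keys x" by (simp add: in_keys_iff)
    qed
    then show ?thesis using that by simp
  qed
qed (auto simp: ring_of_type_algebra_def intro!: poly_mapping_eqI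
      simp: lookup_map_times lookup_add algebra_simps)

lemma module_quotient_module:
  assumes M: "Module.module R M" and "G \<subseteq> carrier M"
  shows "Module.module R (quotient_module M (LinearCombinations.module.span R M G))"
proof -
  interpret M: Module.module R M by (rule M)
  define N where "N = LinearCombinations.module.span R M G"
  have "LinearCombinations.submodule R N M"
    unfolding N_def by (rule LinearCombinations.module.span_is_submodule[OF M assms(2)])
  then interpret N: LinearCombinations.submodule R N M .
  have N_inv: "\<ominus>\<^bsub>M\<^esub> x \<in> N" if "x \<in> N" for x
  proof -
    have "(\<ominus>\<^bsub>R\<^esub> \<one>\<^bsub>R\<^esub>) \<odot>\<^bsub>M\<^esub> x = \<ominus>\<^bsub>M\<^esub> x"
      using that N.subset by (intro M.smult_minus_1) auto
    then show ?thesis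
      using N.smult_closed[OF M.R.a_inv_closed[OF M.R.one_closed] that] by simp
  qed
  have "N \<noteq> {}" using N.zero_closed by blast
  then have "subgroup N (add_monoid M)"
    using N.subset N_inv by (intro M.add.subgroupI) (auto simp: a_inv_def)
  then interpret N: abelian_subgroup N M
    by (intro abelian_subgroupI3 additive_subgroup.intro M.abelian_group_axioms)
  have scale: "(\<Union>x\<in>N +>\<^bsub>M\<^esub> a. N +>\<^bsub>M\<^esub> (r \<odot>\<^bsub>M\<^esub> x)) = N +>\<^bsub>M\<^esub> (r \<odot>\<^bsub>M\<^esub> a)"
    if r: "r \<in> carrier R" and a: "a \<in> carrier M" for r a
  proof -
    have "N +>\<^bsub>M\<^esub> (r \<odot>\<^bsub>M\<^esub> x) = N +>\<^bsub>M\<^esub> (r \<odot>\<^bsub>M\<^esub> a)" if x: "x \<in> N +>\<^bsub>M\<^esub> a" for x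
    proof -
      obtain k where k: "k \<in> N" "x = k \<oplus>\<^bsub>M\<^esub> a"
        using x by (auto simp: a_r_coset_def r_coset_def)
      have "r \<odot>\<^bsub>M\<^esub> x = r \<odot>\<^bsub>M\<^esub> k \<oplus>\<^bsub>M\<^esub> r \<odot>\<^bsub>M\<^esub> a"
        using k r a N.subset by (auto intro: M.smult_r_distr)
      moreover have "r \<odot>\<^bsub>M\<^esub> k \<in> N" using k r by simp
      ultimately have "r \<odot>\<^bsub>M\<^esub> x \<in> N +>\<^bsub>M\<^esub> (r \<odot>\<^bsub>M\<^esub> a)"
        by (auto simp: a_r_coset_def r_coset_def)
      then show ?thesis
        using N.a_repr_independence' r a by simp
    qed
    moreover have "a \<in> N +>\<^bsub>M\<^esub> a" using N.a_rcos_self a by simp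
    ultimately show ?thesis by blast
  qed
  have cosets: "a_rcosets\<^bsub>M\<^esub> N = (\<lambda>a. N +>\<^bsub>M\<^esub> a) ` carrier M"
    by (auto simp: A_RCOSETS_defs a_r_coset_def r_coset_def)
  have carrier: "carrier (quotient_module M N) = (\<lambda>a. N +>\<^bsub>M\<^esub> a) ` carrier M"
    and add: "add (quotient_module M N) = set_add M"
    by (simp_all add: quotient_module_def cosets)
  have smult: "r \<odot>\<^bsub>quotient_module M N\<^esub> (N +>\<^bsub>M\<^esub> a) = N +>\<^bsub>M\<^esub> (r \<odot>\<^bsub>M\<^esub> a)"
    if "r \<in> carrier R" "a \<in> carrier M" for r a
    using scale[OF that] by (simp only: quotient_module_def module.simps)
  have "Module.module R (quotient_module M N)"
  proof (rule moduleI)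
    show "cring R" by (rule M.R.cring_axioms)
    show "abelian_group (quotient_module M N)"
    proof (rule abelian_groupI)
      have zero: "N = N +>\<^bsub>M\<^esub> \<zero>\<^bsub>M\<^esub>"
        using N.a_rcos_const[of "\<zero>\<^bsub>M\<^esub>"] by simp
      show "\<zero>\<^bsub>quotient_module M N\<^esub> \<in> carrier (quotient_module M N)"
        using zero by (auto simp: quotient_module_def cosets)
      show "\<zero>\<^bsub>quotient_module M N\<^esub> \<oplus>\<^bsub>quotient_module M N\<^esub> C = C"
        if "C \<in> carrier (quotient_module M N)" for C
        using that N.rcosets_add_eq by (simp add: quotient_module_def)
      show "\<exists>D\<in>carrier (quotient_module M N).
              D \<oplus>\<^bsub>quotient_module M N\<^esub> C = \<zero>\<^bsub>quotient_module M N\<^esub>"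
        if C: "C \<in> carrier (quotient_module M N)" for C
      proof -
        obtain a where a: "a \<in> carrier M" "C = N +>\<^bsub>M\<^esub> a"
          using C by (auto simp: quotient_module_def cosets)
        then have "(N +>\<^bsub>M\<^esub> \<ominus>\<^bsub>M\<^esub> a) <+>\<^bsub>M\<^esub> C = N"
          using zero by (simp add: N.a_rcos_sum M.M.l_neg)
        then show ?thesis
          using a by (auto simp: quotient_module_def cosets)
      qed
    qed (auto simp: quotient_module_def cosets N.a_rcos_sum M.M.a_ac)
  qed (auto simp: carrier add smult N.a_rcos_sum M.smult_l_distr M.smult_r_distr
      M.smult_assoc1)
  then show ?thesis by (simp add: N_def)
qed

section \<open>Dotted crossingless matchings\<close>

text \<open>Polynomials in \<open>h\<close> and \<open>t\<close> over the integers, as \<open>\<int>[h][t]\<close>.\<close>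

type_synonym int_ht = "int poly poly"

abbreviation Z_ht :: "int_ht ring" where
  "Z_ht \<equiv> ring_of_type_algebra"

definition var_h :: int_ht where "var_h = [:[:0, 1:]:]"
definition var_t :: int_ht where "var_t = [:0, 1:]"

text \<open>An arc is the pair of its endpoints, the left one first.\<close>

type_synonym arc = "nat \<times> nat"

definition crossingless_matching :: "nat \<Rightarrow> arc set \<Rightarrow> bool" where
  "crossingless_matching n A \<longleftrightarrow>
     (\<forall>(p, q)\<in>A. 1 \<le> p \<and> p < q \<and> q \<le> 2 * n) \<and>
     (\<forall>x\<in>{1..2 * n}. \<exists>!e. e \<in> A \<and> (x = fst e \<or> x = snd e)) \<and>
     \<not> (\<exists>a b c d. (a, c) \<in> A \<and> (b, d) \<in> A \<and> a < b \<and> b < c \<and> c < d)"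

text \<open>A diagram is a partial map: its domain is the matching, its values are the numbers of dots.\<close>

type_synonym diagram = "arc \<rightharpoonup> nat"

definition diagrams :: "nat \<Rightarrow> diagram set" where
  "diagrams n = {D. crossingless_matching n (dom D)}"

abbreviation free_diagrams :: "nat \<Rightarrow> (int_ht, diagram \<Rightarrow>\<^sub>0 int_ht) module" where
  "free_diagrams n \<equiv> free_module (diagrams n)"

text \<open>In all relations, \<open>D\<close> is the part of the diagrams away from the arcs shown.\<close>

definition dot_relations :: "nat \<Rightarrow> (diagram \<Rightarrow>\<^sub>0 int_ht) set" where
  "dot_relations n =
     {Poly_Mapping.single (D(e \<mapsto> m + 2)) 1
        - (Poly_Mapping.single (D(e \<mapsto> m + 1)) var_h + Poly_Mapping.single (D(e \<mapsto> m)) var_t)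
      | D e m. D(e \<mapsto> m) \<in> diagrams n}"

text \<open>In the next two sets of relations, \<open>ma\<close>, \<open>mb\<close>, \<open>mc\<close>, \<open>md\<close> are the numbers of extra dots near
  the endpoints \<open>a\<close>, \<open>b\<close>, \<open>c\<close>, \<open>d\<close>; both ends of an arc contribute to its total.
  That both sides lie in \<^term>\<open>diagrams n\<close> forces \<open>D\<close> to have no arcs at \<open>a\<close>, \<open>b\<close>, \<open>c\<close>, \<open>d\<close>.\<close>

definition type_I_relations :: "nat \<Rightarrow> (diagram \<Rightarrow>\<^sub>0 int_ht) set" where
  "type_I_relations n =
     {(let P = (\<lambda>i j. Poly_Mapping.single (D((a, b) \<mapsto> ma + mb + i, (c, d) \<mapsto> mc + md + j)));
           Q = (\<lambda>i j. Poly_Mapping.single (D((a, d) \<mapsto> ma + md + i, (b, c) \<mapsto> mb + mc + j)))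
       in (P 1 0 1 + P 0 1 1 - P 0 0 var_h) - (Q 1 0 1 + Q 0 1 1 - Q 0 0 var_h))
      | D a b c d ma mb mc md.
        a < b \<and> b < c \<and> c < d \<and>
        D((a, b) \<mapsto> ma + mb, (c, d) \<mapsto> mc + md) \<in> diagrams n \<and>
        D((a, d) \<mapsto> ma + md, (b, c) \<mapsto> mb + mc) \<in> diagrams n}"

definition type_II_relations :: "nat \<Rightarrow> (diagram \<Rightarrow>\<^sub>0 int_ht) set" where
  "type_II_relations n =
     {(let P = (\<lambda>i j. Poly_Mapping.single (D((a, b) \<mapsto> ma + mb + i, (c, d) \<mapsto> mc + md + j)));
           Q = (\<lambda>i j. Poly_Mapping.single (D((a, d) \<mapsto> ma + md + i, (b, c) \<mapsto> mb + mc + j)))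
       in (P 1 1 1 + P 0 0 var_t) - (Q 1 1 1 + Q 0 0 var_t))
      | D a b c d ma mb mc md.
        a < b \<and> b < c \<and> c < d \<and>
        D((a, b) \<mapsto> ma + mb, (c, d) \<mapsto> mc + md) \<in> diagrams n \<and>
        D((a, d) \<mapsto> ma + md, (b, c) \<mapsto> mb + mc) \<in> diagrams n}"

definition relations_ht :: "nat \<Rightarrow> (diagram \<Rightarrow>\<^sub>0 int_ht) set" where
  "relations_ht n = LinearCombinations.module.span Z_ht (free_diagrams n)
     (dot_relations n \<union> type_I_relations n \<union> type_II_relations n)"

definition R_ht :: "nat \<Rightarrow> (int_ht, (diagram \<Rightarrow>\<^sub>0 int_ht) set) module" where
  "R_ht n = quotient_module (free_diagrams n) (relations_ht n)"

definition diagram_class :: "nat \<Rightarrow> diagram \<Rightarrow> (diagram \<Rightarrow>\<^sub>0 int_ht) set" where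
  "diagram_class n D = relations_ht n +>\<^bsub>free_diagrams n\<^esub> Poly_Mapping.single D 1"

lemma generators_in_carrier:
  "dot_relations n \<union> type_I_relations n \<union> type_II_relations n \<subseteq> carrier (free_diagrams n)"
    (is "_ \<subseteq> ?F")
proof -
  have add_diff: "f + g \<in> ?F" "f - g \<in> ?F" if "f \<in> ?F" "g \<in> ?F" for f g :: "diagram \<Rightarrow>\<^sub>0 int_ht"
    using that Poly_Mapping.keys_add[of f g] Poly_Mapping.keys_diff[of f g] by auto
  have single: "Poly_Mapping.single D c \<in> ?F" if "D \<in> diagrams n" for D and c :: int_ht
    using that by simp
  have diagram1: "D(e \<mapsto> i) \<in> diagrams n" if "D(e \<mapsto> j) \<in> diagrams n" for D e i j
    using that by (simp add: diagrams_def)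
  have diagram2: "D(e \<mapsto> i, e' \<mapsto> i') \<in> diagrams n" if "D(e \<mapsto> j, e' \<mapsto> j') \<in> diagrams n"
    for D e e' i i' j j'
    using that by (simp add: diagrams_def)
  have "dot_relations n \<subseteq> ?F"
    unfolding dot_relations_def by (clarify, intro add_diff single) (erule diagram1)+
  moreover have "type_I_relations n \<subseteq> ?F"
    unfolding type_I_relations_def Let_def
    by (clarify, intro add_diff single) (erule diagram2)+
  moreover have "type_II_relations n \<subseteq> ?F"
    unfolding type_II_relations_def Let_def
    by (clarify, intro add_diff single) (erule diagram2)+
  ultimately show ?thesis by blast
qed

lemma module_R_ht: "Module.module Z_ht (R_ht n)"
  unfolding R_ht_def relations_ht_def
  by (intro module_quotient_module module_free_module generators_in_carrier)

section \<open>The candidate basis\<close>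

definition outer :: "arc set \<Rightarrow> arc \<Rightarrow> bool" where
  "outer A = (\<lambda>(p, p'). \<not> (\<exists>(e, e')\<in>A. e < p \<and> p' < e'))"

definition B_nk :: "nat \<Rightarrow> nat \<Rightarrow> diagram set" where
  "B_nk n k =
     {D \<in> diagrams n.
        (\<Sum>e\<in>dom D. the (D e)) = k \<and>
        (\<forall>e\<in>dom D. the (D e) \<le> 1) \<and>
        (\<forall>e\<in>dom D. 0 < the (D e) \<longrightarrow> outer (dom D) e)}"

definition B_n :: "nat \<Rightarrow> diagram set" where
  "B_n n = (\<Union>k\<in>{0..n}. B_nk n k)"

end

theory Submission
  imports Defs
begin

text \<open>Let \<open>X\<close> generate the Frobenius algebra \<open>\<int>[h,t][X]/(X\<^sup>2 - hX - t)\<close>, with comultiplication \<open>\<Delta>\<close>.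
  Sending an arc with \<open>m\<close> dots to \<open>\<Delta>(X\<^sup>m)\<close> in the two tensor factors of its endpoints respects all
  relations, because both sides of a type I or type II relation describe a sphere with four holes.
  Ordering monomials in the \<open>X\<^sub>i\<close> so that smaller indices weigh more, a diagram in \<open>B\<^sub>n\<close> has leading
  coefficient \<open>1\<close> at the set of its left endpoints together with the right endpoints of its dotted
  arcs. This set is a ballot sequence and determines the diagram, whence independence and the rank.
  For spanning, a dot on an inner arc is pushed to the innermost enclosing arc by a relation whose
  other terms are less nested or carry cheaper dots.\<close>

text \<open>Independence cannot be read off a presentation, so it must come from functionals that
  kill every relation. Types I and II are the two ways of cutting a tube that joins two arcs: an
  empty tube is replaced by \<Delta>(1) = X \<otimes> 1 + 1 \<otimes> X - h, a tube with a dot by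
  \<Delta>(X) = X \<otimes> X + t. The two sides of a relation cut the same surface along different
  curves and give the same tensor because iterated comultiplication is symmetric. These formulas
  also dictate the monomial order: \<Delta>(1) has two monomials of top degree, and preferring the
  left endpoint is what turns the leading sets into ballot sequences. Such a set has
  \<open>n\<close> elements plus one for each dot, which explains the summation index of the rank
  formula. As \<open>free_rank\<close> is a definite description, the rank further requires that all
  finite bases have the same size. Spanning meets one obstacle: a relation applies only if both
  pairings of its four points are crossingless, hence the insistence on the innermost enclosing
  arc.\<close>

section \<open>Rank of modules over integral domains\<close>

text \<open>Gaussian elimination without division: a pivot row \<open>p\<close> clears column
  \<open>j\<close> by cross-multiplication, and a relation among the remaining rows is pulled back.
  It stays nontrivial because the pivot is not a zero divisor.\<close>

lemma exists_nontrivial_relation: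
  fixes a :: "'i \<Rightarrow> 'j \<Rightarrow> 'r::idom"
  assumes "finite J" "finite I" "card J < card I"
  shows "\<exists>k. (\<exists>i\<in>I. k i \<noteq> 0) \<and> (\<forall>j\<in>J. (\<Sum>i\<in>I. k i * a i j) = 0)"
  using assms
proof (induction J arbitrary: I a rule: finite_induct)
  case empty
  then have "I \<noteq> {}" by auto
  then show ?case by (intro exI[of _ "\<lambda>_. 1"]) auto
next
  case (insert j J)
  show ?case
  proof (cases "\<forall>i\<in>I. a i j = 0")
    case True
    have "card J < card I" using insert by simp
    then obtain k where "\<exists>i\<in>I. k i \<noteq> 0" "\<forall>l\<in>J. (\<Sum>i\<in>I. k i * a i l) = 0"
      using insert.IH[of I a] insert.prems by blast
    with True show ?thesis by (intro exI[of _ k]) auto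
  next
    case False
    then obtain p where p: "p \<in> I" "a p j \<noteq> 0" by blast
    define b where "b i l = a p j * a i l - a i j * a p l" for i l
    have "card J < card (I - {p})" using insert p by simp
    then obtain k where k: "\<exists>i\<in>I - {p}. k i \<noteq> 0" "\<forall>l\<in>J. (\<Sum>i\<in>I - {p}. k i * b i l) = 0"
      using insert.IH[of "I - {p}" b] insert.prems by auto
    define s where "s = (\<Sum>i\<in>I - {p}. k i * a i j)"
    \<comment> \<open>Row \<open>b i\<close> is \<open>a p j\<close> times row \<open>i\<close>
      minus \<open>a i j\<close> times row \<open>p\<close>, so the pivot collects the total
      subtracted multiple, which is \<open>s\<close>.\<close>
    define k' where "k' i = (if i = p then - s else a p j * k i)" for i
    have sum: "(\<Sum>i\<in>I. k' i * a i l) = (\<Sum>i\<in>I - {p}. k i * b i l)" for l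
    proof -
      have "(\<Sum>i\<in>I. k' i * a i l) = - s * a p l + (\<Sum>i\<in>I - {p}. a p j * k i * a i l)"
        using p insert.prems by (simp add: sum.remove k'_def)
      also have "\<dots> = (\<Sum>i\<in>I - {p}. k i * b i l)"
        by (simp add: s_def b_def sum_distrib_left sum_distrib_right sum_subtractf algebra_simps)
      finally show ?thesis .
    qed
    have "\<exists>i\<in>I. k' i \<noteq> 0" using k(1) p(2) by (auto simp: k'_def)
    moreover have "b i j = 0" for i by (simp add: b_def)
    ultimately show ?thesis
      using k(2) sum by (intro exI[of _ k']) auto
  qed
qed

lemma ring_of_type_algebra_simps:
  "carrier ring_of_type_algebra = UNIV" "\<one>\<^bsub>ring_of_type_algebra\<^esub> = 1"
  "\<zero>\<^bsub>ring_of_type_algebra\<^esub> = 0" "x \<oplus>\<^bsub>ring_of_type_algebra\<^esub> y = x + y"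
  "x \<otimes>\<^bsub>ring_of_type_algebra\<^esub> y = x * y"
  by (simp_all add: ring_of_type_algebra_def)

lemma finsum_ring_of_type_algebra:
  fixes f :: "'i \<Rightarrow> 'r::comm_ring_1"
  assumes "finite I"
  shows "finsum ring_of_type_algebra f I = (\<Sum>i\<in>I. f i)"
proof -
  interpret cring "ring_of_type_algebra :: 'r ring" by (rule cring_from_type_algebra)
  show ?thesis
    using assms by (induction I rule: finite_induct) (simp_all add: ring_of_type_algebra_simps)
qed

text \<open>This exchange of summations turns a relation between rows of a coefficient matrix into a
  relation between the vectors that the rows describe.\<close>

lemma (in Module.module) lincomb_lincomb:
  assumes B: "finite B" and C: "finite C" "C \<subseteq> carrier M"
    and k: "k \<in> B \<rightarrow> carrier R" and a: "\<And>b. b \<in> B \<Longrightarrow> a b \<in> C \<rightarrow> carrier R"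
  shows "(\<Oplus>\<^bsub>M\<^esub>b\<in>B. k b \<odot>\<^bsub>M\<^esub> lincomb (a b) C) = lincomb (\<lambda>c. \<Oplus>\<^bsub>R\<^esub>b\<in>B. k b \<otimes>\<^bsub>R\<^esub> a b c) C"
  using B k a
proof (induction B rule: finite_induct)
  case empty
  have "(\<Oplus>\<^bsub>M\<^esub>c\<in>C. \<zero> \<odot>\<^bsub>M\<^esub> c) = \<zero>\<^bsub>M\<^esub>"
    using C by (intro M.add.finprod_one_eqI) auto
  then show ?case by (simp add: lincomb_def)
next
  case (insert b B)
  have kB: "k b \<in> carrier R" "k \<in> B \<rightarrow> carrier R" using insert by auto
  have aB: "a b \<in> C \<rightarrow> carrier R" "\<And>b. b \<in> B \<Longrightarrow> a b \<in> C \<rightarrow> carrier R" using insert by auto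
  have cl: "k b' \<otimes>\<^bsub>R\<^esub> a b' c \<in> carrier R" if "b' \<in> insert b B" "c \<in> C" for b' c
    using that insert.prems(1) insert.prems(2)[OF that(1)] by (auto intro!: R.m_closed simp: Pi_iff)
  have "(\<Oplus>\<^bsub>M\<^esub>b\<in>insert b B. k b \<odot>\<^bsub>M\<^esub> lincomb (a b) C)
      = k b \<odot>\<^bsub>M\<^esub> lincomb (a b) C \<oplus>\<^bsub>M\<^esub> (\<Oplus>\<^bsub>M\<^esub>b\<in>B. k b \<odot>\<^bsub>M\<^esub> lincomb (a b) C)"
    using insert.hyps kB aB C
    by (intro M.finsum_insert) (auto intro!: smult_closed lincomb_closed simp: Pi_iff)
  also have "\<dots> = lincomb (\<lambda>c. k b \<otimes>\<^bsub>R\<^esub> a b c) C \<oplus>\<^bsub>M\<^esub> lincomb (\<lambda>c. \<Oplus>\<^bsub>R\<^esub>b\<in>B. k b \<otimes>\<^bsub>R\<^esub> a b c) C"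
    using insert.IH kB aB C by (simp add: lincomb_smult)
  also have "\<dots> = lincomb (\<lambda>c. \<Oplus>\<^bsub>R\<^esub>b\<in>insert b B. k b \<otimes>\<^bsub>R\<^esub> a b c) C"
  proof -
    have eq: "(\<Oplus>\<^bsub>R\<^esub>b\<in>insert b B. k b \<otimes>\<^bsub>R\<^esub> a b c)
        = k b \<otimes>\<^bsub>R\<^esub> a b c \<oplus>\<^bsub>R\<^esub> (\<Oplus>\<^bsub>R\<^esub>b\<in>B. k b \<otimes>\<^bsub>R\<^esub> a b c)" if "c \<in> C" for c
      using insert.hyps cl that by (intro R.finsum_insert) auto
    have fs: "(\<Oplus>\<^bsub>R\<^esub>b\<in>B. k b \<otimes>\<^bsub>R\<^esub> a b c) \<in> carrier R" if "c \<in> C" for c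
      using cl that by (intro R.finsum_closed) auto
    have "lincomb (\<lambda>c. \<Oplus>\<^bsub>R\<^esub>b\<in>insert b B. k b \<otimes>\<^bsub>R\<^esub> a b c) C
      = (\<Oplus>\<^bsub>M\<^esub>c\<in>C. (k b \<otimes>\<^bsub>R\<^esub> a b c) \<odot>\<^bsub>M\<^esub> c \<oplus>\<^bsub>M\<^esub> (\<Oplus>\<^bsub>R\<^esub>b\<in>B. k b \<otimes>\<^bsub>R\<^esub> a b c) \<odot>\<^bsub>M\<^esub> c)"
      unfolding lincomb_def
      using C cl fs by (intro M.finsum_cong') (auto simp: eq smult_l_distr subset_iff)
    also have "\<dots> = lincomb (\<lambda>c. k b \<otimes>\<^bsub>R\<^esub> a b c) C
        \<oplus>\<^bsub>M\<^esub> lincomb (\<lambda>c. \<Oplus>\<^bsub>R\<^esub>b\<in>B. k b \<otimes>\<^bsub>R\<^esub> a b c) C"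
      unfolding lincomb_def using C cl fs by (intro M.finsum_addf) auto
    finally show ?thesis by simp
  qed
  finally show ?case .
qed

text \<open>Expanding \<open>B\<close> in terms of \<open>C\<close> gives a matrix with one row per
  element of \<open>B\<close>. If it had more rows than columns, a nontrivial relation of its rows
  would be a dependence of \<open>B\<close>.\<close>

lemma card_le_of_lin_indpt_of_span:
  fixes M :: "('r::idom, 'a, 'm) module_scheme"
  assumes M: "Module.module ring_of_type_algebra M"
    and B: "finite B" "B \<subseteq> carrier M" "\<not> LinearCombinations.module.lin_dep ring_of_type_algebra M B"
    and C: "finite C" "C \<subseteq> carrier M" "LinearCombinations.module.span ring_of_type_algebra M C = carrier M"
  shows "card B \<le> card C"
proof (rule ccontr)
  interpret M: Module.module "ring_of_type_algebra :: 'r ring" M by (rule M)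
  assume "\<not> card B \<le> card C"
  have "\<forall>b\<in>B. \<exists>a. b = M.lincomb a C"
    using B(2) M.finite_in_span[OF C(1,2)] C(3) by blast
  then obtain a where a: "\<And>b. b \<in> B \<Longrightarrow> b = M.lincomb (a b) C" by metis
  obtain k where k: "\<exists>b\<in>B. k b \<noteq> 0" "\<forall>c\<in>C. (\<Sum>b\<in>B. k b * a b c) = 0"
    using exists_nontrivial_relation[OF C(1) B(1)] \<open>\<not> card B \<le> card C\<close> by (metis not_le)
  have cl: "f \<in> A \<rightarrow> carrier (ring_of_type_algebra :: 'r ring)" for f and A :: "'c set"
    by (simp add: ring_of_type_algebra_simps)
  have "M.lincomb k B = (\<Oplus>\<^bsub>M\<^esub>b\<in>B. k b \<odot>\<^bsub>M\<^esub> M.lincomb (a b) C)"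
    unfolding M.lincomb_def[of k B]
    using a B(2) C cl by (intro M.M.finsum_cong') (auto simp: ring_of_type_algebra_simps)
  also have "\<dots> = M.lincomb (\<lambda>c. \<Oplus>\<^bsub>ring_of_type_algebra\<^esub>b\<in>B. k b \<otimes>\<^bsub>ring_of_type_algebra\<^esub> a b c) C"
    using B C cl by (intro M.lincomb_lincomb) (auto simp: ring_of_type_algebra_simps)
  also have "\<dots> = (\<Oplus>\<^bsub>M\<^esub>c\<in>C. \<zero>\<^bsub>M\<^esub>)"
    unfolding M.lincomb_def
    using C k(2) B(1) M.lmult_0
    by (intro M.M.finsum_cong')
      (auto simp: ring_of_type_algebra_simps finsum_ring_of_type_algebra subset_iff)
  also have "\<dots> = \<zero>\<^bsub>M\<^esub>" by simp
  finally have "M.lincomb k B = \<zero>\<^bsub>M\<^esub>" .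
  then have "M.lin_dep B"
    using k(1) B(1) cl unfolding M.lin_dep_def by (auto simp: ring_of_type_algebra_simps)
  with B(3) show False by simp
qed

text \<open>The description in \<open>free_rank\<close> denotes something only if the size is
  unique; comparing two bases in both directions gives this.\<close>

lemma free_rank_eq_card:
  fixes M :: "('r::idom, 'a, 'm) module_scheme"
  assumes M: "Module.module ring_of_type_algebra M"
    and B: "module_basis ring_of_type_algebra M B" "finite B"
  shows "free_rank ring_of_type_algebra M = card B"
  unfolding free_rank_def
proof (rule the_equality)
  show "\<exists>B'. module_basis ring_of_type_algebra M B' \<and> finite B' \<and> card B' = card B"
    using B by blast
next
  fix r assume "\<exists>B'. module_basis ring_of_type_algebra M B' \<and> finite B' \<and> card B' = r"
  then obtain B' where "module_basis ring_of_type_algebra M B'" "finite B'" "card B' = r" by blast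
  with B show "r = card B"
    unfolding module_basis_def
    by (metis card_le_of_lin_indpt_of_span[OF M] le_antisym)
qed

section \<open>Quotients of free modules\<close>

lemma map_times_add:
  fixes c :: "'r::comm_ring_1"
  shows "Poly_Mapping.map ((*) c) (f + g) = Poly_Mapping.map ((*) c) f + Poly_Mapping.map ((*) c) g"
  by (intro poly_mapping_eqI) (simp add: lookup_map_times lookup_add algebra_simps)

lemma map_times_minus_1:
  fixes f :: "'d \<Rightarrow>\<^sub>0 'r::comm_ring_1"
  shows "Poly_Mapping.map ((*) (- 1)) f = - f"
  by (intro poly_mapping_eqI) (simp add: lookup_map_times)

lemma map_times_single:
  fixes c :: "'r::comm_ring_1"
  shows "Poly_Mapping.map ((*) c) (Poly_Mapping.single k x) = Poly_Mapping.single k (c * x)"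
  by (intro poly_mapping_eqI) (simp add: lookup_map_times lookup_single when_def)

lemma map_times_sum:
  fixes c :: "'r::comm_ring_1"
  shows "Poly_Mapping.map ((*) c) (\<Sum>i\<in>I. f i) = (\<Sum>i\<in>I. Poly_Mapping.map ((*) c) (f i))"
  by (induction I rule: infinite_finite_induct)
    (simp_all add: map_times_add, auto intro!: poly_mapping_eqI simp: lookup_map_times)

text \<open>The generic part is separated here: a basis of the quotient is reduced to two statements
  about finitely supported functions modulo \<open>N\<close>, so that later sections never handle
  cosets.\<close>

locale free_module_quotient =
  fixes S :: "'d set" and G :: "('d \<Rightarrow>\<^sub>0 'r::comm_ring_1) set"
  assumes G: "G \<subseteq> carrier (free_module S)"
begin

definition N :: "('d \<Rightarrow>\<^sub>0 'r) set" where
  "N = LinearCombinations.module.span ring_of_type_algebra (free_module S) G"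

sublocale F: Module.module "ring_of_type_algebra :: 'r ring" "free_module S"
  by (rule module_free_module)

sublocale Q: Module.module "ring_of_type_algebra :: 'r ring" "quotient_module (free_module S) N"
  unfolding N_def by (rule module_quotient_module[OF module_free_module G])

sublocale N: LinearCombinations.submodule "ring_of_type_algebra :: 'r ring" N "free_module S"
  unfolding N_def by (rule F.span_is_submodule[OF G])

lemma N_zero: "0 \<in> N"
  using N.zero_closed by simp

lemma N_add: "f + g \<in> N" if "f \<in> N" "g \<in> N"
  using N.m_closed[OF that] by simp

lemma N_map_times: "Poly_Mapping.map ((*) c) f \<in> N" if "f \<in> N"
  using N.smult_closed[OF _ that, of c] by (simp add: ring_of_type_algebra_def)

lemma N_minus: "- f \<in> N" if "f \<in> N"
  using N_map_times[OF that, of "- 1"] by (simp only: map_times_minus_1)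

lemma N_diff: "f - g \<in> N" if "f \<in> N" "g \<in> N"
  using N_add[OF that(1) N_minus[OF that(2)]] by simp

lemma N_generator: "g \<in> N" if "g \<in> G"
  unfolding N_def using F.in_own_span[OF G] that by blast

section \<open>Arithmetic of cosets\<close>

definition cls :: "('d \<Rightarrow>\<^sub>0 'r) \<Rightarrow> ('d \<Rightarrow>\<^sub>0 'r) set" where
  "cls f = N +>\<^bsub>free_module S\<^esub> f"

lemma mem_cls: "g \<in> cls f \<longleftrightarrow> g - f \<in> N"
proof -
  have "g \<in> cls f \<longleftrightarrow> (\<exists>h\<in>N. g = h + f)"
    by (simp add: cls_def a_r_coset_def r_coset_def)
  then show ?thesis by (metis add_diff_cancel_right' diff_add_cancel)
qed

lemma cls_eq_iff: "cls f = cls g \<longleftrightarrow> f - g \<in> N"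
proof
  assume "cls f = cls g"
  moreover have "f \<in> cls f" by (simp add: mem_cls N_zero)
  ultimately show "f - g \<in> N" by (simp add: mem_cls)
next
  assume *: "f - g \<in> N"
  have "h - f \<in> N \<longleftrightarrow> h - g \<in> N" for h
    using N_add[OF _ *, of "h - f"] N_diff[OF _ *, of "h - g"] by auto
  then show "cls f = cls g" by (auto simp: mem_cls)
qed

lemma cls_add: "cls f \<oplus>\<^bsub>quotient_module (free_module S) N\<^esub> cls g = cls (f + g)"
proof -
  have "h \<in> cls f <+>\<^bsub>free_module S\<^esub> cls g \<longleftrightarrow> h \<in> cls (f + g)" for h
  proof
    assume "h \<in> cls f <+>\<^bsub>free_module S\<^esub> cls g"
    then obtain x y where "x \<in> cls f" "y \<in> cls g" "h = x + y"
      by (auto simp: set_add_def set_mult_def)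
    then show "h \<in> cls (f + g)"
      using N_add[of "x - f" "y - g"] by (simp add: mem_cls algebra_simps)
  next
    assume "h \<in> cls (f + g)"
    then have "h - g \<in> cls f" by (simp add: mem_cls algebra_simps)
    moreover have "g \<in> cls g" by (simp add: mem_cls N_zero)
    ultimately show "h \<in> cls f <+>\<^bsub>free_module S\<^esub> cls g"
      by (simp add: set_add_def set_mult_def) (metis diff_add_cancel)
  qed
  then show ?thesis by (auto simp: quotient_module_def)
qed

text \<open>Scalar multiplication in the quotient is a union over all representatives. Closure of
  \<open>N\<close> under scalars makes the united cosets coincide, so the union is a single
  coset.\<close>

lemma cls_smult:
  "c \<odot>\<^bsub>quotient_module (free_module S) N\<^esub> cls f = cls (Poly_Mapping.map ((*) c) f)"
proof -
  have "cls (Poly_Mapping.map ((*) c) g) = cls (Poly_Mapping.map ((*) c) f)" if "g \<in> cls f" for g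
  proof -
    have "Poly_Mapping.map ((*) c) (g - f) = Poly_Mapping.map ((*) c) g - Poly_Mapping.map ((*) c) f"
      using map_times_add[of c "g - f" f] by simp
    then show ?thesis using that N_map_times[of "g - f" c] by (simp add: mem_cls cls_eq_iff)
  qed
  moreover have "f \<in> cls f" by (simp add: mem_cls N_zero)
  moreover have "c \<odot>\<^bsub>quotient_module (free_module S) N\<^esub> cls f
      = (\<Union>x\<in>cls f. cls (Poly_Mapping.map ((*) c) x))"
    by (simp add: quotient_module_def cls_def)
  ultimately show ?thesis by blast
qed

lemma carrier_quotient: "carrier (quotient_module (free_module S) N) = cls ` carrier (free_module S)"
  by (auto simp: quotient_module_def A_RCOSETS_defs a_r_coset_def r_coset_def cls_def)

lemma zero_quotient: "\<zero>\<^bsub>quotient_module (free_module S) N\<^esub> = cls 0"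
  by (auto simp: quotient_module_def mem_cls)

lemma finsum_cls:
  assumes "finite I" "\<And>i. i \<in> I \<Longrightarrow> f i \<in> carrier (free_module S)"
  shows "finsum (quotient_module (free_module S) N) (\<lambda>i. cls (f i)) I = cls (\<Sum>i\<in>I. f i)"
  using assms
proof (induction I rule: finite_induct)
  case (insert i I)
  then have "finsum (quotient_module (free_module S) N) (\<lambda>i. cls (f i)) (insert i I)
      = cls (f i) \<oplus>\<^bsub>quotient_module (free_module S) N\<^esub>
          finsum (quotient_module (free_module S) N) (\<lambda>i. cls (f i)) I"
    by (intro Q.M.finsum_insert) (auto simp: carrier_quotient)
  with insert show ?case by (simp add: cls_add)
qed (simp add: zero_quotient)

lemma lincomb_cls:
  assumes "finite B" "B \<subseteq> S" "inj_on (\<lambda>D. cls (Poly_Mapping.single D 1)) B"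
  shows "Q.lincomb a ((\<lambda>D. cls (Poly_Mapping.single D 1)) ` B)
    = cls (\<Sum>D\<in>B. Poly_Mapping.single D (a (cls (Poly_Mapping.single D 1))))"
proof -
  let ?p = "\<lambda>D. cls (Poly_Mapping.single D 1)"
  have car: "?p D \<in> carrier (quotient_module (free_module S) N)" if "D \<in> B" for D
    using that assms(2) by (auto simp: carrier_quotient)
  have "Q.lincomb a (?p ` B) = finsum (quotient_module (free_module S) N)
      (\<lambda>D. a (?p D) \<odot>\<^bsub>quotient_module (free_module S) N\<^esub> ?p D) B"
    unfolding Q.lincomb_def using assms(3) car
    by (intro Q.M.finsum_reindex) (auto simp: ring_of_type_algebra_def intro!: Q.smult_closed)
  also have "\<dots> = finsum (quotient_module (free_module S) N)
      (\<lambda>D. cls (Poly_Mapping.single D (a (?p D)))) B"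
    using assms(2) by (intro Q.M.finsum_cong')
      (auto simp: cls_smult map_times_single carrier_quotient)
  also have "\<dots> = cls (\<Sum>D\<in>B. Poly_Mapping.single D (a (?p D)))"
    using assms by (intro finsum_cls) auto
  finally show ?thesis .
qed

text \<open>Membership of the class of \<open>f\<close> in the span of the classes of
  \<open>B\<close>, phrased on representatives so that each relation acts as a rewriting step
  through \<open>spanned_cong\<close>.\<close>

definition spanned :: "'d set \<Rightarrow> ('d \<Rightarrow>\<^sub>0 'r) \<Rightarrow> bool" where
  "spanned B f \<longleftrightarrow> (\<exists>c. f - (\<Sum>b\<in>B. Poly_Mapping.single b (c b)) \<in> N)"

lemma spanned_cong:
  assumes "spanned B g" "f - g \<in> N"
  shows "spanned B f"
proof -
  obtain c where "g - (\<Sum>b\<in>B. Poly_Mapping.single b (c b)) \<in> N"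
    using assms(1) by (auto simp: spanned_def)
  from N_add[OF assms(2) this] show ?thesis by (auto simp: spanned_def)
qed

lemma spanned_0: "spanned B 0"
  unfolding spanned_def using N_zero by (intro exI[of _ "\<lambda>_. 0"]) simp

lemma spanned_add:
  assumes "spanned B f" "spanned B g"
  shows "spanned B (f + g)"
proof -
  obtain c d where "f - (\<Sum>b\<in>B. Poly_Mapping.single b (c b)) \<in> N"
    "g - (\<Sum>b\<in>B. Poly_Mapping.single b (d b)) \<in> N"
    using assms by (auto simp: spanned_def)
  from N_add[OF this] show ?thesis
    unfolding spanned_def
    by (intro exI[of _ "\<lambda>b. c b + d b"]) (simp add: single_add sum.distrib algebra_simps)
qed

lemma spanned_map_times:
  assumes "spanned B f"
  shows "spanned B (Poly_Mapping.map ((*) x) f)"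
proof -
  obtain c where c: "f - (\<Sum>b\<in>B. Poly_Mapping.single b (c b)) \<in> N"
    using assms by (auto simp: spanned_def)
  have "Poly_Mapping.map ((*) x) (f - (\<Sum>b\<in>B. Poly_Mapping.single b (c b)))
      = Poly_Mapping.map ((*) x) f - (\<Sum>b\<in>B. Poly_Mapping.single b (x * c b))"
    using map_times_add[of x "f - (\<Sum>b\<in>B. Poly_Mapping.single b (c b))" "\<Sum>b\<in>B. Poly_Mapping.single b (c b)"]
    by (simp add: map_times_sum map_times_single)
  with N_map_times[OF c, of x] show ?thesis
    unfolding spanned_def by (intro exI[of _ "\<lambda>b. x * c b"]) simp
qed

lemma spanned_diff: "spanned B f \<Longrightarrow> spanned B g \<Longrightarrow> spanned B (f - g)"
  using spanned_add[of B f "- g"] spanned_map_times[of B g "- 1"] by (simp add: map_times_minus_1)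

lemma spanned_sum: "(\<And>i. i \<in> I \<Longrightarrow> spanned B (f i)) \<Longrightarrow> spanned B (\<Sum>i\<in>I. f i)"
  by (induction I rule: infinite_finite_induct) (auto intro: spanned_0 spanned_add)

lemma spanned_single: "spanned B (Poly_Mapping.single D 1) \<Longrightarrow> spanned B (Poly_Mapping.single D x)"
  using spanned_map_times[of B "Poly_Mapping.single D 1" x] by (simp add: map_times_single)

lemma spanned_base:
  assumes "finite B" "D \<in> B"
  shows "spanned B (Poly_Mapping.single D 1)"
proof -
  have "(\<Sum>b\<in>B. Poly_Mapping.single b (1 when b = D)) = (\<Sum>b\<in>B. if b = D then Poly_Mapping.single D (1::'r) else 0)"
    by (intro sum.cong refl) (simp add: when_def)
  also have "\<dots> = Poly_Mapping.single D 1" using assms by simp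
  finally show ?thesis
    unfolding spanned_def by (intro exI[of _ "\<lambda>b. 1 when b = D"]) (simp add: N_zero)
qed

text \<open>Linearity reduces generation to single diagrams. Injectivity is part of independence:
  two diagrams with the same class would differ by an element of \<open>N\<close> with coefficients
  1 and -1.\<close>

lemma basis_of_quotient:
  assumes B: "finite B" "B \<subseteq> S"
    and gen: "\<And>D. D \<in> S \<Longrightarrow> spanned B (Poly_Mapping.single D 1)"
    and indep: "\<And>c. (\<Sum>b\<in>B. Poly_Mapping.single b (c b)) \<in> N \<Longrightarrow> \<forall>b\<in>B. c b = 0"
  shows "inj_on (\<lambda>D. cls (Poly_Mapping.single D 1)) B" (is "inj_on ?p B")
    and "module_basis ring_of_type_algebra (quotient_module (free_module S) N)
      ((\<lambda>D. cls (Poly_Mapping.single D 1)) ` B)"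
proof -
  show inj: "inj_on ?p B"
  proof (rule inj_onI, rule ccontr)
    fix D D' assume D: "D \<in> B" "D' \<in> B" "?p D = ?p D'" "D \<noteq> D'"
    define c :: "'d \<Rightarrow> 'r" where "c b = (1 when b = D) - (1 when b = D')" for b
    have "(\<Sum>b\<in>B. Poly_Mapping.single b (c b))
        = (\<Sum>b\<in>B. if b = D then Poly_Mapping.single D 1 else 0)
          - (\<Sum>b\<in>B. if b = D' then Poly_Mapping.single D' 1 else 0)"
      unfolding sum_subtractf[symmetric] using D(4)
      by (intro sum.cong refl) (auto simp: c_def single_diff when_def single_uminus)
    also have "\<dots> = Poly_Mapping.single D 1 - Poly_Mapping.single D' 1"
      using B(1) D by simp
    finally have "(\<Sum>b\<in>B. Poly_Mapping.single b (c b)) \<in> N"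
      using D(3) by (simp add: cls_eq_iff)
    then have "c D = 0" using indep D(1) by blast
    with D(4) show False by (simp add: c_def)
  qed
  let ?Q = "quotient_module (free_module S) N"
  have sub: "?p ` B \<subseteq> carrier ?Q"
    using B(2) by (auto simp: carrier_quotient)
  have lin_indpt: "\<not> Q.lin_dep (?p ` B)"
  proof (rule Q.finite_lin_indpt2)
    fix a assume "Q.lincomb a (?p ` B) = \<zero>\<^bsub>?Q\<^esub>"
    then have "(\<Sum>D\<in>B. Poly_Mapping.single D (a (?p D))) \<in> N"
      using lincomb_cls[OF B inj, of a] by (simp add: zero_quotient cls_eq_iff)
    then show "\<forall>v\<in>?p ` B. a v = \<zero>\<^bsub>ring_of_type_algebra\<^esub>"
      using indep[of "\<lambda>D. a (?p D)"] by (simp add: ring_of_type_algebra_def)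
  qed (use B sub in auto)
  have span: "spanned B f" if "Poly_Mapping.keys f \<subseteq> S" for f
  proof -
    have "(\<Sum>D\<in>Poly_Mapping.keys f. Poly_Mapping.single D (Poly_Mapping.lookup f D)) = f"
      by (intro poly_mapping_eqI)
        (simp add: lookup_sum lookup_single when_def in_keys_iff cong: if_cong)
    moreover have "spanned B (\<Sum>D\<in>Poly_Mapping.keys f. Poly_Mapping.single D (Poly_Mapping.lookup f D))"
      using that by (intro spanned_sum, intro spanned_single[OF gen]) blast
    ultimately show ?thesis by simp
  qed
  have "carrier ?Q \<subseteq> Q.span (?p ` B)"
  proof
    fix C assume "C \<in> carrier ?Q"
    then obtain f where f: "Poly_Mapping.keys f \<subseteq> S" "C = cls f"
      by (auto simp: carrier_quotient)
    obtain c where "f - (\<Sum>b\<in>B. Poly_Mapping.single b (c b)) \<in> N"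
      using span[OF f(1)] by (auto simp: spanned_def)
    then have "C = cls (\<Sum>b\<in>B. Poly_Mapping.single b (c b))"
      by (simp add: f(2) cls_eq_iff)
    \<comment> \<open>Coefficients in \<open>lincomb\<close> are indexed by the vectors themselves,
      so they are carried from diagrams to classes along the inverse of the injection.\<close>
    also have "\<dots> = Q.lincomb (\<lambda>v. c (the_inv_into B ?p v)) (?p ` B)"
      unfolding lincomb_cls[OF B inj]
      by (intro arg_cong[of _ _ cls] sum.cong) (simp_all add: the_inv_into_f_f[OF inj])
    also have "\<dots> \<in> Q.span (?p ` B)"
      using B(1) Q.finite_span[OF finite_imageI[OF B(1)] sub] by (auto simp: ring_of_type_algebra_def)
    finally show "C \<in> Q.span (?p ` B)" .
  qed
  moreover have "Q.span (?p ` B) \<subseteq> carrier ?Q"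
    using Q.span_is_subset2[OF sub] .
  ultimately show "module_basis ring_of_type_algebra ?Q (?p ` B)"
    using sub lin_indpt by (auto simp: module_basis_def)
qed

end

section \<open>Crossingless matchings\<close>

definition matching_on :: "nat set \<Rightarrow> arc set \<Rightarrow> bool" where
  "matching_on V A \<longleftrightarrow>
     (\<forall>(p, q)\<in>A. p \<in> V \<and> q \<in> V \<and> p < q) \<and>
     (\<forall>x\<in>V. \<exists>!e. e \<in> A \<and> (x = fst e \<or> x = snd e)) \<and>
     \<not> (\<exists>a b c d. (a, c) \<in> A \<and> (b, d) \<in> A \<and> a < b \<and> b < c \<and> c < d)"

lemma crossingless_matching_eq_matching_on:
  "crossingless_matching n = matching_on {1..2 * n}"
proof
  fix A
  have "(\<forall>(p, q)\<in>A. 1 \<le> p \<and> p < q \<and> q \<le> 2 * n) \<longleftrightarrow>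
      (\<forall>(p, q)\<in>A. p \<in> {1..2 * n} \<and> q \<in> {1..2 * n} \<and> p < q)"
    by fastforce
  then show "crossingless_matching n A = matching_on {1..2 * n} A"
    by (simp only: crossingless_matching_def matching_on_def)
qed

context
  fixes V A
  assumes M: "matching_on V A"
begin

lemma matching_onD:
  assumes "(p, q) \<in> A"
  shows "p \<in> V" "q \<in> V" "p < q"
  using M assms by (auto simp: matching_on_def)

lemma matching_on_ex: "x \<in> V \<Longrightarrow> \<exists>e\<in>A. x = fst e \<or> x = snd e"
  using M unfolding matching_on_def by blast

lemma matching_on_unique:
  assumes "e \<in> A" "e' \<in> A" "x = fst e \<or> x = snd e" "x = fst e' \<or> x = snd e'"
  shows "e = e'"
proof -
  have "x \<in> V" using assms(1,3) matching_onD[of "fst e" "snd e"] by auto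
  then have "\<exists>!e. e \<in> A \<and> (x = fst e \<or> x = snd e)"
    using M by (simp add: matching_on_def)
  with assms show ?thesis by blast
qed

lemma matching_on_noncrossing:
  "(a, c) \<in> A \<Longrightarrow> (b, d) \<in> A \<Longrightarrow> a < b \<Longrightarrow> b < c \<Longrightarrow> d \<le> c"
  using M unfolding matching_on_def by (meson not_le)

lemma matching_on_finite: "finite V \<Longrightarrow> finite A"
  using matching_onD by (intro finite_subset[of A "V \<times> V"]) auto

text \<open>The arcs partition the vertices into pairs of endpoints. This yields the number of arcs
  and lets weights be compared arc by arc.\<close>

lemma sum_matching_on:
  assumes "finite V"
  shows "(\<Sum>x\<in>V. f x) = (\<Sum>e\<in>A. f (fst e) + f (snd e))"
proof -
  have V: "V = (\<Union>e\<in>A. {fst e, snd e})"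
    using matching_on_ex matching_onD by fastforce
  have "(\<Sum>x\<in>V. f x) = (\<Sum>e\<in>A. \<Sum>x\<in>{fst e, snd e}. f x)"
    unfolding V
  proof (intro sum.UNION_disjoint ballI impI)
    show "finite A" using matching_on_finite[OF assms] .
    fix e e' assume *: "e \<in> A" "e' \<in> A" "e \<noteq> e'"
    show "{fst e, snd e} \<inter> {fst e', snd e'} = {}"
    proof (rule ccontr)
      assume "{fst e, snd e} \<inter> {fst e', snd e'} \<noteq> {}"
      then obtain x where "x = fst e \<or> x = snd e" "x = fst e' \<or> x = snd e'" by blast
      with matching_on_unique * show False by blast
    qed
  qed simp
  also have "\<dots> = (\<Sum>e\<in>A. f (fst e) + f (snd e))"
  proof (intro sum.cong refl)
    fix e assume "e \<in> A"
    then have "fst e < snd e" using matching_onD(3)[of "fst e" "snd e"] by simp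
    then show "(\<Sum>x\<in>{fst e, snd e}. f x) = f (fst e) + f (snd e)" by simp
  qed
  finally show ?thesis .
qed

end

section \<open>Functionals vanishing on the relations\<close>

text \<open>\<open>X\<^sup>m = X_pow_0 m + X_pow_1 m X\<close> in \<open>\<int>[h,t][X]/(X\<^sup>2 - hX - t)\<close>.\<close>

fun X_pow_1 :: "nat \<Rightarrow> int_ht" where
  "X_pow_1 0 = 0"
| "X_pow_1 (Suc 0) = 1"
| "X_pow_1 (Suc (Suc m)) = var_h * X_pow_1 (Suc m) + var_t * X_pow_1 m"

fun X_pow_0 :: "nat \<Rightarrow> int_ht" where
  "X_pow_0 0 = 1"
| "X_pow_0 (Suc 0) = 0"
| "X_pow_0 (Suc (Suc m)) = var_h * X_pow_0 (Suc m) + var_t * X_pow_0 m"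

text \<open>The Booleans say whether \<open>X\<close> occurs in the first and in the second tensor factor of a basis
  element; the values are the coefficients of \<open>\<Delta>(X\<^sup>m)\<close>, from \<open>\<Delta>(1) = X \<otimes> 1 + 1 \<otimes> X - h\<close> and
  \<open>\<Delta>(X) = X \<otimes> X + t\<close>.\<close>

definition arc_coeff :: "nat \<Rightarrow> bool \<Rightarrow> bool \<Rightarrow> int_ht" where
  "arc_coeff m x y = (if x \<and> y then X_pow_1 m else if x \<or> y then X_pow_0 m
     else var_t * X_pow_1 m - var_h * X_pow_0 m)"

lemma arc_coeff_dot_reduction:
  "arc_coeff (m + 2) x y = var_h * arc_coeff (m + 1) x y + var_t * arc_coeff m x y"
  by (simp add: arc_coeff_def numeral_2_eq_2 algebra_simps)

text \<open>One side of a type I relation whose two arcs already carry \<open>i\<close> and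
  \<open>j\<close> dots: a coefficient of X_1 + X_2 - h applied to \<Delta>(X^i) \<otimes>
  \<Delta>(X^j), where X_1 and X_2 put a dot on the first and the second arc.\<close>

definition saddle :: "nat \<Rightarrow> nat \<Rightarrow> bool \<Rightarrow> bool \<Rightarrow> bool \<Rightarrow> bool \<Rightarrow> int_ht" where
  "saddle i j x y z w = arc_coeff (i + 1) x y * arc_coeff j z w
     + arc_coeff i x y * arc_coeff (j + 1) z w - var_h * (arc_coeff i x y * arc_coeff j z w)"

text \<open>Multiplying X_1 + X_2 - h by X_2 and using X_2^2 = h X_2 + t leaves X_1 X_2 + t. So a
  side of a type II relation is a saddle with one more dot.\<close>

lemma saddle_Suc_right:
  "saddle i (j + 1) x y z w = arc_coeff (i + 1) x y * arc_coeff (j + 1) z w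
     + var_t * (arc_coeff i x y * arc_coeff j z w)"
  using arc_coeff_dot_reduction[of j z w]
  by (simp add: saddle_def algebra_simps)

lemma saddle_Suc_left:
  "saddle (i + 1) j x y z w = arc_coeff (i + 1) x y * arc_coeff (j + 1) z w
     + var_t * (arc_coeff i x y * arc_coeff j z w)"
  using arc_coeff_dot_reduction[of i x y]
  by (simp add: saddle_def algebra_simps)

text \<open>A further dot on either arc produces the symmetric expression X_1 X_2 + t, so dots slide
  through the tube and only their total matters.\<close>

lemma saddle_shift: "saddle i j x y z w = saddle 0 (i + j) x y z w"
proof (induction i arbitrary: j)
  case (Suc i)
  have "saddle (i + 1) j x y z w = saddle i (j + 1) x y z w"
    by (simp only: saddle_Suc_left saddle_Suc_right)
  with Suc[of "j + 1"] show ?case by simp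
qed simp

text \<open>Both sides satisfy the recurrence of the powers of X in \<open>m\<close>, which leaves
  \<open>m = 0\<close> and \<open>m = 1\<close>; there the sixteen basis tensors are
  checked.\<close>

lemma saddle_0_rotate: "saddle 0 m x y z w = saddle 0 m x w y z"
proof (induction m rule: induct_nat_012)
  case (ge2 m)
  have "saddle 0 (m + 2) x y z w = var_h * saddle 0 (m + 1) x y z w + var_t * saddle 0 m x y z w"
    for x y z w
    using arc_coeff_dot_reduction[of m z w] arc_coeff_dot_reduction[of "m + 1" z w]
    by (simp add: saddle_def algebra_simps)
  with ge2 show ?case by simp
qed (cases x; cases y; cases z; cases w; simp add: saddle_def arc_coeff_def algebra_simps)+

lemma saddle_rotate: "saddle i j x y z w = saddle k l x w y z" if "i + j = k + l"
  using saddle_shift[of i j x y z w] saddle_shift[of k l x w y z] saddle_0_rotate that by simp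

section \<open>Linear functionals on the free module of diagrams\<close>

definition linear_extension :: "('d \<Rightarrow> 'r::comm_ring_1) \<Rightarrow> ('d \<Rightarrow>\<^sub>0 'r) \<Rightarrow> 'r" where
  "linear_extension g f = (\<Sum>D\<in>Poly_Mapping.keys f. Poly_Mapping.lookup f D * g D)"

lemma linear_extension_superset:
  assumes "finite A" "Poly_Mapping.keys f \<subseteq> A"
  shows "linear_extension g f = (\<Sum>D\<in>A. Poly_Mapping.lookup f D * g D)"
  unfolding linear_extension_def
  using assms by (intro sum.mono_neutral_left) (auto simp: in_keys_iff)

lemma linear_extension_0 [simp]: "linear_extension g 0 = 0"
  by (simp add: linear_extension_def)

lemma linear_extension_add:
  "linear_extension g (f + f') = linear_extension g f + linear_extension g f'"
proof -
  let ?A = "Poly_Mapping.keys f \<union> Poly_Mapping.keys f'"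
  have "linear_extension g (f + f') = (\<Sum>D\<in>?A. Poly_Mapping.lookup (f + f') D * g D)"
    by (intro linear_extension_superset) (auto simp: keys_add)
  moreover have "linear_extension g f = (\<Sum>D\<in>?A. Poly_Mapping.lookup f D * g D)"
    "linear_extension g f' = (\<Sum>D\<in>?A. Poly_Mapping.lookup f' D * g D)"
    by (auto intro: linear_extension_superset)
  ultimately show ?thesis by (simp add: lookup_add distrib_right sum.distrib)
qed

lemma linear_extension_diff:
  "linear_extension g (f - f') = linear_extension g f - linear_extension g f'"
  using linear_extension_add[of g "f - f'" f'] by simp

lemma linear_extension_map_times:
  "linear_extension g (Poly_Mapping.map ((*) c) f) = c * linear_extension g f"
proof -
  have "Poly_Mapping.keys (Poly_Mapping.map ((*) c) f) \<subseteq> Poly_Mapping.keys f"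
    by (auto simp: in_keys_iff lookup_map_times)
  then show ?thesis
    by (simp add: linear_extension_superset[of "Poly_Mapping.keys f"] lookup_map_times
        sum_distrib_left mult.assoc)
qed

lemma linear_extension_single [simp]:
  "linear_extension g (Poly_Mapping.single D c) = c * g D"
  by (simp add: linear_extension_def)

lemma linear_extension_sum:
  "linear_extension g (\<Sum>i\<in>I. f i) = (\<Sum>i\<in>I. linear_extension g (f i))"
  by (induction I rule: infinite_finite_induct) (simp_all add: linear_extension_add)

text \<open>Coefficient of the monomial \<open>\<Prod>\<^bsub>i\<in>T\<^esub> X\<^sub>i\<close> in the image of a diagram.\<close>

definition state_coeff :: "nat set \<Rightarrow> diagram \<Rightarrow> int_ht" where
  "state_coeff T D = (\<Prod>e\<in>dom D. arc_coeff (the (D e)) (fst e \<in> T) (snd e \<in> T))"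

lemma diagrams_finite_dom: "D \<in> diagrams n \<Longrightarrow> finite (dom D)"
  using matching_on_finite[of "{1..2 * n}"]
  by (simp add: diagrams_def crossingless_matching_eq_matching_on)

text \<open>Restricting \<open>D\<close> discards a previous value at \<open>e\<close>. The formula
  thus also covers dot relations whose \<open>D\<close> already contains the arc.\<close>

lemma state_coeff_update:
  assumes "finite (dom D)"
  shows "state_coeff T (D(e \<mapsto> m)) = arc_coeff m (fst e \<in> T) (snd e \<in> T) * state_coeff T (D |` (- {e}))"
proof -
  have "(\<Prod>e'\<in>dom D - {e}. arc_coeff (the ((D(e \<mapsto> m)) e')) (fst e' \<in> T) (snd e' \<in> T))
     = state_coeff T (D |` (- {e}))"
    unfolding state_coeff_def by (rule prod.cong) auto
  with assms show ?thesis
    by (simp add: state_coeff_def prod.insert_remove)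
qed

lemma state_coeff_update2:
  assumes "finite (dom D)" "e \<notin> dom D" "e' \<notin> dom D" "e \<noteq> e'"
  shows "state_coeff T (D(e \<mapsto> i, e' \<mapsto> j)) = arc_coeff i (fst e \<in> T) (snd e \<in> T)
    * arc_coeff j (fst e' \<in> T) (snd e' \<in> T) * state_coeff T D"
proof -
  have "D |` (- {e}) = D" "(D(e \<mapsto> i)) |` (- {e'}) = D(e \<mapsto> i)"
    using assms by (auto simp: restrict_map_def fun_eq_iff domIff)
  with assms show ?thesis by (simp add: state_coeff_update)
qed

text \<open>Each of the four arcs shares an endpoint with an arc of the other pairing. As every
  point lies on one arc only, the first diagram keeps \<open>(a, d)\<close> and
  \<open>(b, c)\<close> out of \<open>D\<close>, and the second keeps out \<open>(a, b)\<close> and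
  \<open>(c, d)\<close>; the factors therefore separate.\<close>

lemma state_coeff_saddle:
  assumes "a < b" "b < c" "c < d"
    and P: "D((a, b) \<mapsto> ma, (c, d) \<mapsto> mb) \<in> diagrams n"
    and Q: "D((a, d) \<mapsto> mc, (b, c) \<mapsto> md) \<in> diagrams n"
  shows "state_coeff T (D((a, b) \<mapsto> i, (c, d) \<mapsto> j)) =
        arc_coeff i (a \<in> T) (b \<in> T) * arc_coeff j (c \<in> T) (d \<in> T) * state_coeff T D"
      "state_coeff T (D((a, d) \<mapsto> i, (b, c) \<mapsto> j)) =
        arc_coeff i (a \<in> T) (d \<in> T) * arc_coeff j (b \<in> T) (c \<in> T) * state_coeff T D"
proof -
  let ?P = "D((a, b) \<mapsto> ma, (c, d) \<mapsto> mb)" and ?Q = "D((a, d) \<mapsto> mc, (b, c) \<mapsto> md)"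
  have MP: "matching_on {1..2 * n} (dom ?P)" and MQ: "matching_on {1..2 * n} (dom ?Q)"
    using P Q by (simp_all add: diagrams_def crossingless_matching_eq_matching_on)
  have fin: "finite (dom D)" using diagrams_finite_dom[OF P] by simp
  have "(a, d) \<notin> dom D" "(b, c) \<notin> dom D"
    using matching_on_unique[OF MP, of "(a, b)" "(a, d)" a]
      matching_on_unique[OF MP, of "(a, b)" "(b, c)" b] assms by auto
  moreover have "(a, b) \<notin> dom D" "(c, d) \<notin> dom D"
    using matching_on_unique[OF MQ, of "(a, d)" "(a, b)" a]
      matching_on_unique[OF MQ, of "(a, d)" "(c, d)" d] assms by auto
  ultimately show "state_coeff T (D((a, b) \<mapsto> i, (c, d) \<mapsto> j)) =
        arc_coeff i (a \<in> T) (b \<in> T) * arc_coeff j (c \<in> T) (d \<in> T) * state_coeff T D"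
      "state_coeff T (D((a, d) \<mapsto> i, (b, c) \<mapsto> j)) =
        arc_coeff i (a \<in> T) (d \<in> T) * arc_coeff j (b \<in> T) (c \<in> T) * state_coeff T D"
    using assms(1-3) fin by (simp_all add: state_coeff_update2)
qed

lemma state_coeff_dot_relations:
  assumes "r \<in> dot_relations n"
  shows "linear_extension (state_coeff T) r = 0"
proof -
  obtain D e m where r: "r = Poly_Mapping.single (D(e \<mapsto> m + 2)) 1
      - (Poly_Mapping.single (D(e \<mapsto> m + 1)) var_h + Poly_Mapping.single (D(e \<mapsto> m)) var_t)"
    and D: "D(e \<mapsto> m) \<in> diagrams n"
    using assms unfolding dot_relations_def by blast
  have "finite (dom D)" using diagrams_finite_dom[OF D] by simp
  then show ?thesis
    unfolding r linear_extension_diff linear_extension_add linear_extension_single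
    by (simp only: state_coeff_update arc_coeff_dot_reduction) (simp add: algebra_simps)
qed

text \<open>The extra dots near the endpoints add up to \<open>ma + mb + mc + md\<close> on both
  sides, and \<open>saddle_rotate\<close> depends on that total alone.\<close>

lemma state_coeff_type_I_relations:
  assumes "r \<in> type_I_relations n"
  shows "linear_extension (state_coeff T) r = 0"
proof -
  obtain D a b c d ma mb mc md where
    r: "r = (let P = (\<lambda>i j. Poly_Mapping.single (D((a, b) \<mapsto> ma + mb + i, (c, d) \<mapsto> mc + md + j)));
           Q = (\<lambda>i j. Poly_Mapping.single (D((a, d) \<mapsto> ma + md + i, (b, c) \<mapsto> mb + mc + j)))
       in (P 1 0 1 + P 0 1 1 - P 0 0 var_h) - (Q 1 0 1 + Q 0 1 1 - Q 0 0 var_h))"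
    and *: "a < b" "b < c" "c < d" "D((a, b) \<mapsto> ma + mb, (c, d) \<mapsto> mc + md) \<in> diagrams n"
        "D((a, d) \<mapsto> ma + md, (b, c) \<mapsto> mb + mc) \<in> diagrams n"
    using assms unfolding type_I_relations_def by blast
  have "linear_extension (state_coeff T) r =
     saddle (ma + mb) (mc + md) (a \<in> T) (b \<in> T) (c \<in> T) (d \<in> T) * state_coeff T D
     - saddle (ma + md) (mb + mc) (a \<in> T) (d \<in> T) (b \<in> T) (c \<in> T) * state_coeff T D"
    unfolding r Let_def linear_extension_diff linear_extension_add linear_extension_single
      state_coeff_saddle[OF *]
    by (simp add: saddle_def algebra_simps)
  also have "saddle (ma + mb) (mc + md) (a \<in> T) (b \<in> T) (c \<in> T) (d \<in> T) =
      saddle (ma + md) (mb + mc) (a \<in> T) (d \<in> T) (b \<in> T) (c \<in> T)"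
    by (rule saddle_rotate) simp
  finally show ?thesis by simp
qed

text \<open>By \<open>saddle_Suc_right\<close> each side is a saddle with one more dot on its second
  arc, so the symmetry behind type I applies again.\<close>

lemma state_coeff_type_II_relations:
  assumes "r \<in> type_II_relations n"
  shows "linear_extension (state_coeff T) r = 0"
proof -
  obtain D a b c d ma mb mc md where
    r: "r = (let P = (\<lambda>i j. Poly_Mapping.single (D((a, b) \<mapsto> ma + mb + i, (c, d) \<mapsto> mc + md + j)));
           Q = (\<lambda>i j. Poly_Mapping.single (D((a, d) \<mapsto> ma + md + i, (b, c) \<mapsto> mb + mc + j)))
       in (P 1 1 1 + P 0 0 var_t) - (Q 1 1 1 + Q 0 0 var_t))"
    and *: "a < b" "b < c" "c < d" "D((a, b) \<mapsto> ma + mb, (c, d) \<mapsto> mc + md) \<in> diagrams n"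
        "D((a, d) \<mapsto> ma + md, (b, c) \<mapsto> mb + mc) \<in> diagrams n"
    using assms unfolding type_II_relations_def by blast
  have "linear_extension (state_coeff T) r =
     saddle (ma + mb) (mc + md + 1) (a \<in> T) (b \<in> T) (c \<in> T) (d \<in> T) * state_coeff T D
     - saddle (ma + md) (mb + mc + 1) (a \<in> T) (d \<in> T) (b \<in> T) (c \<in> T) * state_coeff T D"
    unfolding r Let_def linear_extension_diff linear_extension_add linear_extension_single
      state_coeff_saddle[OF *] saddle_Suc_right
    by (simp add: algebra_simps)
  also have "saddle (ma + mb) (mc + md + 1) (a \<in> T) (b \<in> T) (c \<in> T) (d \<in> T) =
      saddle (ma + md) (mb + mc + 1) (a \<in> T) (d \<in> T) (b \<in> T) (c \<in> T)"
    by (rule saddle_rotate) simp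
  finally show ?thesis by simp
qed

text \<open>The kernel of the functional is a submodule containing the generators, hence their
  span.\<close>

lemma state_coeff_relations_ht:
  assumes "r \<in> relations_ht n"
  shows "linear_extension (state_coeff T) r = 0"
proof -
  interpret F: Module.module Z_ht "free_diagrams n" by (rule module_free_module)
  let ?K = "{f \<in> carrier (free_diagrams n). linear_extension (state_coeff T) f = 0}"
  have "LinearCombinations.submodule Z_ht ?K (free_diagrams n)"
  proof (unfold_locales; (intro conjI)?)
    show "f \<oplus>\<^bsub>free_diagrams n\<^esub> g \<in> ?K" if "f \<in> ?K" "g \<in> ?K" for f g
      using that F.M.add.m_closed[of f g] by (auto simp: linear_extension_add)
    show "c \<odot>\<^bsub>free_diagrams n\<^esub> f \<in> ?K" if "c \<in> carrier Z_ht" "f \<in> ?K" for c f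
      using that F.smult_closed[of c f] by (auto simp: linear_extension_map_times)
  qed (use F.module_axioms in auto)
  then have "F.span (dot_relations n \<union> type_I_relations n \<union> type_II_relations n) \<subseteq> ?K"
    using generators_in_carrier[of n] state_coeff_dot_relations state_coeff_type_I_relations
      state_coeff_type_II_relations
    by (intro F.span_is_subset) auto
  with assms show ?thesis by (auto simp: relations_ht_def)
qed

section \<open>Outer-dotted diagrams and ballot sequences\<close>

lemma matching_on_remove:
  assumes M: "matching_on V A" and e: "(u, d) \<in> A"
  shows "matching_on (V - {u, d}) (A - {(u, d)})"
proof -
  have ne: "x \<noteq> u" "x \<noteq> d" if "e' \<in> A" "e' \<noteq> (u, d)" "x = fst e' \<or> x = snd e'" for x e'
    using matching_on_unique[OF M that(1) e that(3)] that(2) by auto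
  have "\<exists>!e. e \<in> A - {(u, d)} \<and> (x = fst e \<or> x = snd e)" if "x \<in> V - {u, d}" for x
  proof -
    from that have "x \<in> V" by simp
    then obtain e where "e \<in> A" "x = fst e \<or> x = snd e"
      using matching_on_ex[OF M] by blast
    moreover from this have "e \<noteq> (u, d)" using that by auto
    ultimately show ?thesis using matching_on_unique[OF M] by blast
  qed
  moreover have "p \<in> V - {u, d} \<and> q \<in> V - {u, d} \<and> p < q" if pq: "(p, q) \<in> A" "(p, q) \<noteq> (u, d)" for p q
    using matching_onD[OF M pq(1)] ne[OF pq, of p] ne[OF pq, of q] by simp
  then have "\<forall>(p, q)\<in>A - {(u, d)}. p \<in> V - {u, d} \<and> q \<in> V - {u, d} \<and> p < q"
    by blast
  moreover have "\<not> (\<exists>a b c d'. (a, c) \<in> A - {(u, d)} \<and> (b, d') \<in> A - {(u, d)} \<and> a < b \<and> b < c \<and> c < d')"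
  proof (rule notI, elim exE conjE)
    fix a b c d' assume "(a, c) \<in> A - {(u, d)}" "(b, d') \<in> A - {(u, d)}" "a < b" "b < c" "c < d'"
    then show False using matching_on_noncrossing[OF M, of a c b d'] by simp
  qed
  ultimately show ?thesis by (simp add: matching_on_def)
qed

lemma matching_on_insert:
  assumes M: "matching_on V A" and "u < d" "u \<notin> V" "d \<notin> V"
    and nc: "\<And>x y. (x, y) \<in> A \<Longrightarrow> \<not> (x < u \<and> u < y \<and> y < d) \<and> \<not> (u < x \<and> x < d \<and> d < y)"
  shows "matching_on (insert u (insert d V)) (insert (u, d) A)"
proof -
  have A: "fst e \<in> V \<and> snd e \<in> V" if "e \<in> A" for e
    using matching_onD[OF M, of "fst e" "snd e"] that by simp
  have "\<exists>!e. e \<in> insert (u, d) A \<and> (x = fst e \<or> x = snd e)" if "x \<in> insert u (insert d V)" for x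
  proof (cases "x \<in> V")
    case True
    then obtain e where "e \<in> A" "x = fst e \<or> x = snd e" using matching_on_ex[OF M] by blast
    moreover have "e' \<in> A" if "e' \<in> insert (u, d) A" "x = fst e' \<or> x = snd e'" for e'
      using that True assms(3,4) by auto
    ultimately show ?thesis
      using matching_on_unique[OF M, of _ e x] by (intro ex1I[of _ e]) blast+
  next
    case False
    with that have "x = u \<or> x = d" by simp
    then show ?thesis using False A by (intro ex1I[of _ "(u, d)"]) auto
  qed
  moreover have "\<forall>(p, q)\<in>insert (u, d) A.
      p \<in> insert u (insert d V) \<and> q \<in> insert u (insert d V) \<and> p < q"
    using matching_onD[OF M] \<open>u < d\<close> by auto
  moreover have "\<not> (\<exists>a b c d'. (a, c) \<in> insert (u, d) A \<and> (b, d') \<in> insert (u, d) A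
      \<and> a < b \<and> b < c \<and> c < d')"
  proof clarify
    fix a b c d'
    assume *: "(a, c) \<in> insert (u, d) A" "(b, d') \<in> insert (u, d) A" "a < b" "b < c" "c < d'"
    show False
      using nc[of a c] nc[of b d'] matching_on_noncrossing[OF M, of a c b d'] * by auto
  qed
  ultimately show ?thesis by (simp add: matching_on_def)
qed

text \<open>The analogue of \<open>B_n\<close> on any vertex set, for the induction that peels off
  arcs; the number of dots is left free.\<close>

definition outer_dotted :: "nat set \<Rightarrow> diagram \<Rightarrow> bool" where
  "outer_dotted V D \<longleftrightarrow> matching_on V (dom D) \<and> (\<forall>e\<in>dom D. the (D e) \<le> 1) \<and>
     (\<forall>e\<in>dom D. 0 < the (D e) \<longrightarrow> outer (dom D) e)"

definition up_set :: "diagram \<Rightarrow> nat set" where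
  "up_set D = {x. \<exists>e\<in>dom D. x = fst e \<or> x = snd e \<and> the (D e) \<noteq> 0}"

lemma card_matching:
  assumes "matching_on {1..2 * n} A"
  shows "card A = n"
  using sum_matching_on[OF assms, of "\<lambda>_. 1::nat"] by simp

text \<open>A matching of 2n points has n arcs with at most one dot each, so every outer-dotted
  diagram has its dot count among 0, ..., n.\<close>

lemma B_n_eq: "B_n n = {D. outer_dotted {1..2 * n} D}"
proof -
  have "(\<Sum>e\<in>dom D. the (D e)) \<le> n" if "outer_dotted {1..2 * n} D" for D
  proof -
    have "(\<Sum>e\<in>dom D. the (D e)) \<le> (\<Sum>e\<in>dom D. 1)"
      using that by (intro sum_mono) (auto simp: outer_dotted_def)
    moreover have "card (dom D) = n"
      using that card_matching unfolding outer_dotted_def by blast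
    ultimately show ?thesis by simp
  qed
  then show ?thesis
    by (auto simp: B_n_def B_nk_def diagrams_def outer_dotted_def crossingless_matching_eq_matching_on)
qed

lemma fst_in_up_set: "e \<in> dom D \<Longrightarrow> fst e \<in> up_set D"
  by (auto simp: up_set_def)

lemma snd_in_up_set:
  assumes "matching_on V (dom D)" "e \<in> dom D"
  shows "snd e \<in> up_set D \<longleftrightarrow> the (D e) \<noteq> 0"
proof
  assume "snd e \<in> up_set D"
  then obtain e' where e': "e' \<in> dom D" "snd e = fst e' \<or> snd e = snd e' \<and> the (D e') \<noteq> 0"
    by (auto simp: up_set_def)
  then have "e' = e" using matching_on_unique[OF assms(1), of e' e] assms(2) by auto
  moreover have "fst e < snd e" using matching_onD(3)[OF assms(1), of "fst e" "snd e"] assms(2) by simp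
  ultimately show "the (D e) \<noteq> 0" using e' by auto
qed (use assms in \<open>auto simp: up_set_def\<close>)

lemma up_set_subset:
  assumes "matching_on V (dom D)"
  shows "up_set D \<subseteq> V"
  using matching_onD[OF assms] by (fastforce simp: up_set_def)

text \<open>Points of \<open>S\<close> are up-steps and the other points of \<open>V\<close>
  down-steps of a lattice path that never drops below its start; its final height is not
  prescribed.\<close>

definition ballot :: "nat set \<Rightarrow> nat set \<Rightarrow> bool" where
  "ballot V S \<longleftrightarrow> S \<subseteq> V \<and> (\<forall>x. card {v \<in> V - S. v \<le> x} \<le> card {v \<in> S. v \<le> x})"

text \<open>A point outside the up-set closes an undotted arc. Sending it to the left end of that
  arc injects the down points up to \<open>x\<close> into the up points up to
  \<open>x\<close>.\<close>

lemma ballot_up_set: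
  assumes "finite V" and M: "matching_on V (dom D)"
  shows "ballot V (up_set D)"
  unfolding ballot_def
proof (intro conjI allI)
  show "up_set D \<subseteq> V" by (rule up_set_subset[OF M])
  fix x
  have "\<exists>u. (u, v) \<in> dom D" if v: "v \<in> V - up_set D" for v
  proof -
    obtain e where "e \<in> dom D" "v = fst e \<or> v = snd e"
      using matching_on_ex[OF M, of v] v by blast
    with v fst_in_up_set[of e D] show ?thesis by (cases e) auto
  qed
  then obtain f where f: "\<And>v. v \<in> V - up_set D \<Longrightarrow> (f v, v) \<in> dom D" by metis
  show "card {v \<in> V - up_set D. v \<le> x} \<le> card {v \<in> up_set D. v \<le> x}"
  proof (rule card_inj_on_le)
    show "inj_on f {v \<in> V - up_set D. v \<le> x}"
    proof (rule inj_onI)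
      fix v w assume *: "v \<in> {v \<in> V - up_set D. v \<le> x}" "w \<in> {v \<in> V - up_set D. v \<le> x}" "f v = f w"
      then have "(f v, v) = (f w, w)"
        using matching_on_unique[OF M f f, of v w "f v"] by auto
      then show "v = w" by simp
    qed
    show "f ` {v \<in> V - up_set D. v \<le> x} \<subseteq> {v \<in> up_set D. v \<le> x}"
    proof (clarify, intro conjI)
      fix v assume v: "v \<in> V" "v \<notin> up_set D" "v \<le> x"
      then have "(f v, v) \<in> dom D" using f by simp
      then show "f v \<in> up_set D" "f v \<le> x"
        using fst_in_up_set[of "(f v, v)" D] matching_onD(3)[OF M] v by fastforce+
    qed
    show "finite {v \<in> up_set D. v \<le> x}"
      using up_set_subset[OF M] \<open>finite V\<close> by (auto intro: finite_subset)
  qed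
qed

lemma outer_iff: "outer A e \<longleftrightarrow> (\<forall>e'\<in>A. \<not> (fst e' < fst e \<and> snd e < snd e'))"
  by (cases e) (auto simp: outer_def)

lemma outer_insert: "outer (insert e A) e' \<longleftrightarrow> \<not> (fst e < fst e' \<and> snd e' < snd e) \<and> outer A e'"
  by (auto simp: outer_iff)

lemma outerD: "outer A (p, q) \<Longrightarrow> (x, y) \<in> A \<Longrightarrow> x < p \<Longrightarrow> y \<le> q"
  by (fastforce simp: outer_iff)

lemma up_set_update:
  assumes "e \<notin> dom D"
  shows "up_set (D(e \<mapsto> m)) = (if m = 0 then {fst e} else {fst e, snd e}) \<union> up_set D"
proof -
  have "e' \<noteq> e" if "e' \<in> dom D" for e' using that assms by auto
  then have "(\<exists>e'\<in>insert e (dom D). x = fst e' \<or> x = snd e' \<and> the ((D(e \<mapsto> m)) e') \<noteq> 0) \<longleftrightarrow>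
      x = fst e \<or> x = snd e \<and> m \<noteq> 0 \<or> (\<exists>e'\<in>dom D. x = fst e' \<or> x = snd e' \<and> the (D e') \<noteq> 0)" for x
    by (simp cong: bex_cong)
  then show ?thesis by (auto simp: up_set_def simp del: fun_upd_apply)
qed

lemma outer_dotted_remove:
  assumes "outer_dotted V D" "(u, d) \<in> dom D"
  shows "outer_dotted (V - {u, d}) (D((u, d) := None))"
    and "up_set (D((u, d) := None)) = up_set D - {u, d}"
proof -
  have M: "matching_on V (dom D)" using assms by (simp add: outer_dotted_def)
  have "outer (dom D - {(u, d)}) e" if "outer (dom D) e" for e
    using that outer_insert[of "(u, d)" "dom D - {(u, d)}" e] insert_Diff[OF assms(2)] by simp
  then show "outer_dotted (V - {u, d}) (D((u, d) := None))"
    using matching_on_remove[OF M assms(2)] assms(1) by (auto simp: outer_dotted_def)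
  obtain m where m: "D (u, d) = Some m" using assms(2) by blast
  let ?D = "D((u, d) := None)"
  have disj: "x \<noteq> u \<and> x \<noteq> d" if "x \<in> up_set ?D" for x
  proof -
    obtain e where "e \<in> dom D" "e \<noteq> (u, d)" "x = fst e \<or> x = snd e"
      using \<open>x \<in> up_set ?D\<close> by (auto simp: up_set_def simp del: fun_upd_apply)
    then show ?thesis using matching_on_unique[OF M _ assms(2), of e x] by auto
  qed
  have up: "up_set D = (if m = 0 then {u} else {u, d}) \<union> up_set ?D"
    using up_set_update[of "(u, d)" ?D m] m by (simp add: fun_upd_idem)
  show "up_set ?D = up_set D - {u, d}"
    unfolding up using disj by (cases "m = 0") (simp_all del: fun_upd_apply, blast+)
qed

text \<open>With no old vertex between \<open>u\<close> and \<open>d\<close>, the new arc crosses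
  and covers nothing, so outer arcs stay outer. A dot is put on it only if it starts left of
  everything, which makes it outer itself.\<close>

lemma outer_dotted_insert:
  assumes D: "outer_dotted V D" and "u < d" "u \<notin> V" "d \<notin> V"
    and gap: "\<And>v. v \<in> V \<Longrightarrow> \<not> (u < v \<and> v < d)"
    and m: "m = 0 \<or> m = 1 \<and> (\<forall>v\<in>V. u < v)"
  shows "outer_dotted (insert u (insert d V)) (D((u, d) \<mapsto> m))"
    and "up_set (D((u, d) \<mapsto> m)) = (if m = 0 then {u} else {u, d}) \<union> up_set D"
proof -
  have M: "matching_on V (dom D)" using D by (simp add: outer_dotted_def)
  have V: "fst e \<in> V" "snd e \<in> V" if "e \<in> dom D" for e
    using matching_onD[OF M, of "fst e" "snd e"] that by auto
  have notin: "(u, d) \<notin> dom D" using V[of "(u, d)"] assms(3) by auto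
  have match: "matching_on (insert u (insert d V)) (insert (u, d) (dom D))"
  proof (rule matching_on_insert[OF M assms(2-4)])
    fix x y assume "(x, y) \<in> dom D"
    then have "x \<in> V" "y \<in> V" using V[of "(x, y)"] by simp_all
    then show "\<not> (x < u \<and> u < y \<and> y < d) \<and> \<not> (u < x \<and> x < d \<and> d < y)"
      using gap[of x] gap[of y] by auto
  qed
  have dom: "dom (D((u, d) \<mapsto> m)) = insert (u, d) (dom D)" by simp
  show "outer_dotted (insert u (insert d V)) (D((u, d) \<mapsto> m))"
    unfolding outer_dotted_def dom
  proof (intro conjI ballI impI match)
    fix e assume e: "e \<in> insert (u, d) (dom D)"
    show "the ((D((u, d) \<mapsto> m)) e) \<le> 1"
    proof (cases "e = (u, d)")
      case False
      then show ?thesis using e D by (simp add: outer_dotted_def)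
    qed (use m in auto)
    assume dots: "0 < the ((D((u, d) \<mapsto> m)) e)"
    show "outer (insert (u, d) (dom D)) e"
    proof (cases "e = (u, d)")
      case True
      with dots m have "\<forall>v\<in>V. u < v" by auto
      then have "outer (dom D) (u, d)"
        unfolding outer_iff using V(1) by (metis fst_conv less_asym)
      with True show ?thesis by (simp add: outer_insert)
    next
      case False
      then have eD: "e \<in> dom D" using e by simp
      then have "outer (dom D) e" using D dots False by (simp add: outer_dotted_def)
      moreover have "\<not> (u < fst e \<and> snd e < d)"
        using gap[OF V(1)[OF eD]] matching_onD(3)[OF M, of "fst e" "snd e"] eD
        by (metis less_trans prod.collapse)
      ultimately show ?thesis by (simp add: outer_insert)
    qed
  qed
  show "up_set (D((u, d) \<mapsto> m)) = (if m = 0 then {u} else {u, d}) \<union> up_set D"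
    using up_set_update[OF notin] by simp
qed

text \<open>The point \<open>d\<close> closes an undotted arc \<open>(x, d)\<close>. If
  \<open>x < u\<close>, an arc starting at \<open>u\<close> would have to end strictly between
  \<open>u\<close> and \<open>d\<close>, where there is no vertex, and a dotted arc ending at
  \<open>u\<close> would either lie below \<open>(x, d)\<close>, against outerness, or cross
  it.\<close>

lemma first_down_arc:
  assumes D: "outer_dotted V D" and d: "d \<in> V - up_set D"
    and u: "u \<in> up_set D" "u < d" "\<And>v. v \<in> V \<Longrightarrow> \<not> (u < v \<and> v < d)"
  shows "D (u, d) = Some 0"
proof -
  have M: "matching_on V (dom D)" using D by (simp add: outer_dotted_def)
  obtain e where e: "e \<in> dom D" "d = fst e \<or> d = snd e" using matching_on_ex[OF M] d by blast
  then have "d = snd e" using d fst_in_up_set[OF e(1)] by auto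
  then obtain x where x: "(x, d) \<in> dom D" using e by (cases e) auto
  then have zero: "the (D (x, d)) = 0" using snd_in_up_set[OF M x] d by simp
  have "x = u"
  proof (rule ccontr)
    assume "x \<noteq> u"
    have "x < d" "x \<in> V" using matching_onD[OF M x] by auto
    with u(3) \<open>x \<noteq> u\<close> have "x < u" by (metis linorder_neqE_nat)
    obtain e' where e': "e' \<in> dom D" "u = fst e' \<or> u = snd e' \<and> the (D e') \<noteq> 0"
      using u(1) by (auto simp: up_set_def)
    from e'(2) show False
    proof
      assume "u = fst e'"
      then obtain y where y: "(u, y) \<in> dom D" using e' by (cases e') auto
      have "y \<le> d" using matching_on_noncrossing[OF M x y \<open>x < u\<close> u(2)] .
      moreover have "y \<noteq> d" using matching_on_unique[OF M x y, of d] \<open>x \<noteq> u\<close> by auto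
      ultimately show False using matching_onD[OF M y] u(3)[of y] by auto
    next
      assume *: "u = snd e' \<and> the (D e') \<noteq> 0"
      define w where "w = fst e'"
      have "(w, u) = e'" using * by (simp add: w_def)
      then have w: "(w, u) \<in> dom D" "the (D (w, u)) \<noteq> 0" using e'(1) * by simp_all
      then have "outer (dom D) (w, u)" using D unfolding outer_dotted_def by blast
      then have "\<not> x < w" using outerD[OF _ x] u(2) by (meson not_le)
      moreover have "\<not> w < x" using matching_on_noncrossing[OF M w(1) x _ \<open>x < u\<close>] u(2) by linarith
      moreover have "w \<noteq> x" using matching_on_unique[OF M w(1) x, of x] u(2) by auto
      ultimately show False by simp
    qed
  qed
  with x zero show ?thesis by auto
qed

text \<open>If every point is up, every arc is dotted and hence outer, so nothing is nested. Were
  the partner of the minimum beyond \<open>d\<close>, an arc starting at \<open>d\<close> would be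
  nested, and one ending at \<open>d\<close> would have to start at \<open>u\<close> too.\<close>

lemma all_up_first_arc:
  assumes D: "outer_dotted V D" and up: "up_set D = V"
    and u: "u \<in> V" "\<And>v. v \<in> V \<Longrightarrow> u \<le> v"
    and d: "d \<in> V" "u < d" "\<And>v. v \<in> V \<Longrightarrow> \<not> (u < v \<and> v < d)"
  shows "D (u, d) = Some 1"
proof -
  have M: "matching_on V (dom D)" using D by (simp add: outer_dotted_def)
  have one: "the (D e) = 1" and out: "outer (dom D) e" if "e \<in> dom D" for e
  proof -
    have "snd e \<in> V" using matching_onD[OF M, of "fst e" "snd e"] that by simp
    then have "the (D e) \<noteq> 0" using snd_in_up_set[OF M that] up by simp
    moreover have "the (D e) \<le> 1" using D that by (simp add: outer_dotted_def)
    ultimately show "the (D e) = 1" by simp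
    then show "outer (dom D) e" using D that by (simp add: outer_dotted_def)
  qed
  obtain e where e: "e \<in> dom D" "u = fst e \<or> u = snd e" using matching_on_ex[OF M u(1)] by blast
  have "fst e \<in> V" "fst e < snd e" using matching_onD[OF M, of "fst e" "snd e"] e(1) by simp_all
  with e(2) u(2)[of "fst e"] have "u = fst e" by auto
  then obtain y where y: "(u, y) \<in> dom D" using e(1) by (cases e) auto
  have "y = d"
  proof (rule ccontr)
    assume "y \<noteq> d"
    with d(3)[of y] matching_onD[OF M y] have "d < y" by auto
    obtain e' where e': "e' \<in> dom D" "d = fst e' \<or> d = snd e'" using matching_on_ex[OF M d(1)] by blast
    from e'(2) show False
    proof
      assume "d = fst e'"
      then obtain z where z: "(d, z) \<in> dom D" using e' by (cases e') auto
      have "z \<le> y" using matching_on_noncrossing[OF M y z d(2) \<open>d < y\<close>] .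
      moreover have "z \<noteq> y" using matching_on_unique[OF M y z, of y] d(2) by auto
      ultimately show False using outerD[OF out[OF z] y d(2)] by simp
    next
      assume "d = snd e'"
      then obtain w where w: "(w, d) \<in> dom D" using e' by (cases e') auto
      have "w = u" using matching_onD[OF M w] u(2)[of w] d(3)[of w] by auto
      then show False using matching_on_unique[OF M w y, of u] \<open>y \<noteq> d\<close> by auto
    qed
  qed
  with y one[OF y] show ?thesis by auto
qed

text \<open>The diagram is rebuilt from its up-set by matching the first down point with the up point
  just before it; once no down point is left, consecutive up points are joined by dotted arcs.\<close>

lemma ex1_outer_dotted:
  assumes "finite V" "even (card V)" "ballot V S"
  shows "\<exists>!D. outer_dotted V D \<and> up_set D = S"
  using assms
proof (induction "card V" arbitrary: V S rule: less_induct)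
  case less
  \<comment> \<open>Both cases share this step: once the arc at \<open>u\<close>, \<open>d\<close>
    and its dots are forced, uniqueness passes to the smaller vertex set and existence comes from
    reinserting the arc.\<close>
  have step: ?case if ud: "u \<in> V" "d \<in> V" "u < d" "\<And>v. v \<in> V \<Longrightarrow> \<not> (u < v \<and> v < d)"
    and m: "m = 0 \<or> m = 1 \<and> (\<forall>v\<in>V - {u, d}. u < v)"
    and bal: "ballot (V - {u, d}) (S - {u, d})" and S: "(if m = 0 then {u} else {u, d}) \<union> (S - {u, d}) = S"
    and arc: "\<And>D. outer_dotted V D \<Longrightarrow> up_set D = S \<Longrightarrow> D (u, d) = Some m" for u d m
  proof -
    have card: "card V = card (V - {u, d}) + 2"
    proof -
      have "card {u, d} = 2" using ud(3) by simp
      moreover have "card {u, d} \<le> card V" using ud less.prems(1) by (intro card_mono) auto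
      moreover have "card (V - {u, d}) = card V - card {u, d}"
        using ud by (intro card_Diff_subset) auto
      ultimately show ?thesis by simp
    qed
    have "\<exists>!D. outer_dotted (V - {u, d}) D \<and> up_set D = S - {u, d}"
    proof (rule less.hyps[OF _ _ _ bal])
      show "card (V - {u, d}) < card V" using card by linarith
      show "even (card (V - {u, d}))" using less.prems(2) unfolding card by (simp only: even_add even_numeral)
    qed (use less.prems(1) in simp)
    then obtain D where D': "outer_dotted (V - {u, d}) D \<and> up_set D = S - {u, d}"
      and uniq: "\<forall>D'. outer_dotted (V - {u, d}) D' \<and> up_set D' = S - {u, d} \<longrightarrow> D' = D"
      by (erule ex1E)
    from D' have D: "outer_dotted (V - {u, d}) D" "up_set D = S - {u, d}" by blast+
    have V: "insert u (insert d (V - {u, d})) = V" using ud by auto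
    have notin: "u \<notin> V - {u, d}" "d \<notin> V - {u, d}" by simp_all
    have gap: "\<And>v. v \<in> V - {u, d} \<Longrightarrow> \<not> (u < v \<and> v < d)" using ud(4) by simp
    show ?thesis
    proof (intro ex1I[of _ "D((u, d) \<mapsto> m)"] conjI)
      show "outer_dotted V (D((u, d) \<mapsto> m))"
        using outer_dotted_insert(1)[OF D(1) ud(3) notin gap m] unfolding V .
      show "up_set (D((u, d) \<mapsto> m)) = S"
        using outer_dotted_insert(2)[OF D(1) ud(3) notin gap m] unfolding D(2) S .
    next
      fix D' assume D': "outer_dotted V D' \<and> up_set D' = S"
      then have "D' (u, d) = Some m" using arc by blast
      moreover from this have "D'((u, d) := None) = D"
        using D' outer_dotted_remove[of V D' u d] by (intro uniq[rule_format]) auto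
      ultimately show "D' = D((u, d) \<mapsto> m)" by (metis fun_upd_triv fun_upd_upd)
    qed
  qed
  have SV: "S \<subseteq> V" using less.prems by (simp add: ballot_def)
  consider "V = {}" | "V \<noteq> {}" "S = V" | "S \<noteq> V" by blast
  then show ?case
  proof cases
    case 1
    have "outer_dotted {} D \<longleftrightarrow> D = Map.empty" for D
    proof
      assume "outer_dotted {} D"
      then have "matching_on {} (dom D)" by (simp add: outer_dotted_def)
      then have "dom D = {}" using matching_onD(1) by fastforce
      then show "D = Map.empty" by simp
    qed (simp add: outer_dotted_def matching_on_def)
    moreover have "S = {}" using SV 1 by simp
    ultimately show ?thesis using 1 by (auto simp: up_set_def)
  next
    case 2
    define u where "u = Min V"
    define d where "d = Min (V - {u})"
    have u: "u \<in> V" "\<And>v. v \<in> V \<Longrightarrow> u \<le> v" using less.prems(1) 2 by (auto simp: u_def)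
    \<comment> \<open>Evenness guarantees that a second point exists.\<close>
    have "V \<noteq> {u}" using less.prems(2) by auto
    then have ne: "V - {u} \<noteq> {}" using u by auto
    have d: "d \<in> V - {u}" "\<And>v. v \<in> V - {u} \<Longrightarrow> d \<le> v"
      using less.prems(1) Min_in[OF _ ne] by (auto simp: d_def)
    have "u < d" using u(2)[of d] d(1) by auto
    show ?thesis
    proof (rule step[of u d 1])
      have *: "\<not> (u < v \<and> v < d)" if "v \<in> V" for v using d(2)[of v] that by auto
      then show "\<And>v. v \<in> V \<Longrightarrow> \<not> (u < v \<and> v < d)" .
      show "D (u, d) = Some 1" if "outer_dotted V D" "up_set D = S" for D
        using that 2 u d \<open>u < d\<close> * by (intro all_up_first_arc[of V]) auto
      show "1 = 0 \<or> 1 = 1 \<and> (\<forall>v\<in>V - {u, d}. u < v)" using u(2) by fastforce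
      show "ballot (V - {u, d}) (S - {u, d})" using 2 by (simp add: ballot_def)
    qed (use u d \<open>u < d\<close> 2 in auto)
  next
    case 3
    define d where "d = Min (V - S)"
    have ne: "V - S \<noteq> {}" using 3 SV by auto
    have d: "d \<in> V - S" "\<And>v. v \<in> V - S \<Longrightarrow> d \<le> v"
      using less.prems(1) Min_in[OF _ ne] by (auto simp: d_def)
    have bal: "card {v \<in> V - S. v \<le> x} \<le> card {v \<in> S. v \<le> x}" for x
      using less.prems by (simp add: ballot_def)
    have finS: "finite S" using SV less.prems(1) finite_subset by blast
    \<comment> \<open>The ballot condition at the first down point provides an up point before it,
      so \<open>d\<close> has a predecessor in \<open>V\<close>.\<close>
    have "0 < card {v \<in> V - S. v \<le> d}"
      using d(1) less.prems(1) by (auto simp: card_gt_0_iff)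
    then have "card {v \<in> S. v \<le> d} \<noteq> 0" using bal[of d] by linarith
    then obtain x where "x \<in> S" "x \<le> d" by (metis (no_types, lifting) Collect_empty_eq card.empty)
    moreover from this d(1) have "x \<noteq> d" by auto
    ultimately have ne': "{v \<in> V. v < d} \<noteq> {}" using SV by (auto simp: order_le_less)
    define u where "u = Max {v \<in> V. v < d}"
    have u: "u \<in> V" "u < d" "\<And>v. v \<in> V \<Longrightarrow> v < d \<Longrightarrow> v \<le> u"
      using Max_in[OF _ ne'] less.prems(1) by (auto simp: u_def)
    have "u \<in> S" using u d(2)[of u] by auto
    show ?thesis
    proof (rule step[of u d 0])
      have *: "\<not> (u < v \<and> v < d)" if "v \<in> V" for v using u(3)[of v] that by auto
      then show "\<And>v. v \<in> V \<Longrightarrow> \<not> (u < v \<and> v < d)" .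
      show "D (u, d) = Some 0" if "outer_dotted V D" "up_set D = S" for D
        using that d \<open>u \<in> S\<close> u * by (intro first_down_arc[of V]) auto
      \<comment> \<open>Before \<open>u\<close> nothing changes, between \<open>u\<close> and
        \<open>d\<close> there is no down point yet, and from \<open>d\<close> on both counts drop
        by one.\<close>
      have "card {v \<in> V - {u, d} - (S - {u, d}). v \<le> x} \<le> card {v \<in> S - {u, d}. v \<le> x}" for x
      proof -
        consider "x < u" | "u \<le> x" "x < d" | "d \<le> x" by linarith
        then show ?thesis
        proof cases
          case 1
          then have "{v \<in> V - {u, d} - (S - {u, d}). v \<le> x} = {v \<in> V - S. v \<le> x}"
            "{v \<in> S - {u, d}. v \<le> x} = {v \<in> S. v \<le> x}" using u(2) by auto
          then show ?thesis using bal by simp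
        next
          case 2
          then have "{v \<in> V - {u, d} - (S - {u, d}). v \<le> x} = {}" using d(2) by fastforce
          then show ?thesis by (simp only: card.empty le0)
        next
          case 3
          then have eq: "{v \<in> V - {u, d} - (S - {u, d}). v \<le> x} = {v \<in> V - S. v \<le> x} - {d}"
            "{v \<in> S - {u, d}. v \<le> x} = {v \<in> S. v \<le> x} - {u}"
            using \<open>u \<in> S\<close> d(1) by auto
          have "d \<in> {v \<in> V - S. v \<le> x}" "u \<in> {v \<in> S. v \<le> x}"
            using 3 d(1) \<open>u \<in> S\<close> u(2) by auto
          then show ?thesis
            unfolding eq using bal[of x] by (simp only: card_Diff_singleton diff_le_mono)
        qed
      qed
      then show "ballot (V - {u, d}) (S - {u, d})" using SV by (auto simp: ballot_def)
    qed (use u d \<open>u \<in> S\<close> in auto)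
  qed
qed

section \<open>The bijection with ballot sequences\<close>

lemma bij_betw_up_set:
  assumes "finite V" "even (card V)"
  shows "bij_betw up_set {D. outer_dotted V D} {S. ballot V S}"
  unfolding bij_betw_def
proof (intro conjI inj_onI equalityI subsetI)
  fix D D' assume "D \<in> {D. outer_dotted V D}" "D' \<in> {D. outer_dotted V D}" "up_set D = up_set D'"
  moreover from this have "ballot V (up_set D)"
    using ballot_up_set[OF assms(1)] by (auto simp: outer_dotted_def)
  ultimately show "D = D'" using ex1_outer_dotted[OF assms, of "up_set D"] by auto
next
  fix S assume "S \<in> {S. ballot V S}"
  then show "S \<in> up_set ` {D. outer_dotted V D}" using ex1_outer_dotted[OF assms, of S] by auto
next
  fix S assume "S \<in> up_set ` {D. outer_dotted V D}"
  then show "S \<in> {S. ballot V S}" using ballot_up_set[OF assms(1)] by (auto simp: outer_dotted_def)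
qed

lemma matching_on_B_n: "D \<in> B_n n \<Longrightarrow> matching_on {1..2 * n} (dom D)"
  unfolding B_n_eq outer_dotted_def by blast

lemma bij_betw_up_set_B_n: "bij_betw up_set (B_n n) {S. ballot {1..2 * n} S}"
  unfolding B_n_eq by (rule bij_betw_up_set) simp_all

lemma finite_B_n: "finite (B_n n)"
proof -
  have "up_set D \<subseteq> {1..2 * n}" if "D \<in> B_n n" for D
    by (rule up_set_subset[OF matching_on_B_n[OF that]])
  then have "up_set ` B_n n \<subseteq> Pow {1..2 * n}" by blast
  then have "finite (up_set ` B_n n)" by (rule finite_subset) simp
  then show ?thesis using bij_betw_imp_inj_on[OF bij_betw_up_set_B_n] by (rule finite_imageD)
qed

section \<open>Linear independence\<close>

definition weight :: "nat \<Rightarrow> nat set \<Rightarrow> nat" where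
  "weight n T = (\<Sum>x\<in>{1..2 * n}. if x \<in> T then 2 * n + 1 - x else 0)"

text \<open>Every factor is the coefficient of X \<otimes> 1 in \<Delta>(1) or of X \<otimes> X in
  \<Delta>(X).\<close>

lemma state_coeff_up_set:
  assumes D: "D \<in> B_n n"
  shows "state_coeff (up_set D) D = 1"
  unfolding state_coeff_def
proof (rule prod.neutral, rule ballI)
  fix e assume e: "e \<in> dom D"
  have M: "matching_on {1..2 * n} (dom D)" by (rule matching_on_B_n[OF D])
  have "the (D e) \<le> 1" using D e unfolding B_n_eq outer_dotted_def by blast
  then consider "the (D e) = 0" | "the (D e) = 1" by linarith
  then show "arc_coeff (the (D e)) (fst e \<in> up_set D) (snd e \<in> up_set D) = 1"
    by cases (use fst_in_up_set[OF e] snd_in_up_set[OF M e] in \<open>simp_all add: arc_coeff_def\<close>)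
qed

text \<open>An undotted arc contributes only the monomials X_a, X_b and 1, a dotted one only X_a X_b
  and 1. In both cases the up-set picks the strictly heaviest, so equal total weights force
  agreement on every arc.\<close>

lemma weight_le_weight_up_set:
  assumes D: "D \<in> B_n n" and nz: "state_coeff T D \<noteq> 0"
  shows "weight n T \<le> weight n (up_set D)"
    and "weight n T = weight n (up_set D) \<Longrightarrow> T \<subseteq> {1..2 * n} \<Longrightarrow> T = up_set D"
proof -
  let ?V = "{1..2 * n}"
  let ?f = "\<lambda>T x. if x \<in> T then 2 * n + 1 - x else 0"
  let ?g = "\<lambda>T e. ?f T (fst e) + ?f T (snd e)"
  have M: "matching_on ?V (dom D)" by (rule matching_on_B_n[OF D])
  have dots: "the (D e) \<le> 1" if "e \<in> dom D" for e
    using D that unfolding B_n_eq outer_dotted_def by blast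
  have fin: "finite (dom D)" using matching_on_finite[OF M] by simp
  have weight: "weight n T = (\<Sum>e\<in>dom D. ?g T e)" for T
    unfolding weight_def by (rule sum_matching_on[OF M]) simp
  have arc: "?g T e \<le> ?g (up_set D) e \<and> (?g T e = ?g (up_set D) e \<longrightarrow>
      (fst e \<in> T \<longleftrightarrow> fst e \<in> up_set D) \<and> (snd e \<in> T \<longleftrightarrow> snd e \<in> up_set D))" if e: "e \<in> dom D" for e
  proof -
    have coeff: "arc_coeff (the (D e)) (fst e \<in> T) (snd e \<in> T) \<noteq> 0"
      using nz e fin by (auto simp: state_coeff_def)
    have lt: "fst e < snd e" "snd e \<le> 2 * n"
      using matching_onD[OF M, of "fst e" "snd e"] e by auto
    have up: "fst e \<in> up_set D" "snd e \<in> up_set D \<longleftrightarrow> the (D e) \<noteq> 0"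
      using fst_in_up_set[OF e] snd_in_up_set[OF M e] by blast+
    show ?thesis
    proof (cases "the (D e) = 0")
      case True
      with coeff have "\<not> (fst e \<in> T \<and> snd e \<in> T)" by (auto simp: arc_coeff_def)
      with True lt up show ?thesis by (cases "fst e \<in> T"; cases "snd e \<in> T") (simp_all, arith)
    next
      case False
      then have "the (D e) = 1" using dots[OF e] by linarith
      with coeff have "fst e \<in> T \<longleftrightarrow> snd e \<in> T"
        by (auto simp: arc_coeff_def split: if_splits)
      with False lt up show ?thesis by (cases "fst e \<in> T"; cases "snd e \<in> T") simp_all
    qed
  qed
  show "weight n T \<le> weight n (up_set D)"
    unfolding weight using arc by (intro sum_mono) blast
  show "T = up_set D" if eq: "weight n T = weight n (up_set D)" and T: "T \<subseteq> ?V"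
  proof -
    have "x \<in> T \<longleftrightarrow> x \<in> up_set D" if x: "x \<in> ?V" for x
    proof -
      obtain e where e: "e \<in> dom D" "x = fst e \<or> x = snd e" using matching_on_ex[OF M x] by blast
      have "?g T e = ?g (up_set D) e"
        using eq arc e(1) fin unfolding weight by (intro sum_mono_inv[of "?g T" "dom D" "?g (up_set D)"]) blast+
      with arc[OF e(1)] e(2) show ?thesis by blast
    qed
    with T up_set_subset[OF M] show ?thesis by blast
  qed
qed

text \<open>Among the diagrams with nonzero coefficient take one of maximal weight and read off the
  coefficient of its leading monomial. Another diagram contributing there would have the same
  weight, hence the same up-set.\<close>

lemma B_n_independent:
  assumes "(\<Sum>D\<in>B_n n. Poly_Mapping.single D (c D)) \<in> relations_ht n"
  shows "\<forall>D\<in>B_n n. c D = 0"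
proof (rule ccontr)
  assume "\<not> (\<forall>D\<in>B_n n. c D = 0)"
  then have ne: "{D \<in> B_n n. c D \<noteq> 0} \<noteq> {}" by auto
  have fin: "finite {D \<in> B_n n. c D \<noteq> 0}" using finite_B_n by simp
  define w where "w D = weight n (up_set D)" for D
  obtain D0 where D0: "D0 \<in> B_n n" "c D0 \<noteq> 0"
    and max: "\<And>D. D \<in> B_n n \<Longrightarrow> c D \<noteq> 0 \<Longrightarrow> w D \<le> w D0"
  proof -
    have "Max (w ` {D \<in> B_n n. c D \<noteq> 0}) \<in> w ` {D \<in> B_n n. c D \<noteq> 0}"
      using ne fin by (intro Max_in) auto
    then obtain D0 where "D0 \<in> B_n n" "c D0 \<noteq> 0" "w D0 = Max (w ` {D \<in> B_n n. c D \<noteq> 0})" by auto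
    moreover have "w D \<le> Max (w ` {D \<in> B_n n. c D \<noteq> 0})" if "D \<in> B_n n" "c D \<noteq> 0" for D
      using fin that by (intro Max_ge) auto
    ultimately show ?thesis using that by simp
  qed
  have zero: "c D * state_coeff (up_set D0) D = 0" if D: "D \<in> B_n n" "D \<noteq> D0" for D
  proof (rule ccontr)
    assume "c D * state_coeff (up_set D0) D \<noteq> 0"
    then have nz: "c D \<noteq> 0" "state_coeff (up_set D0) D \<noteq> 0" by auto
    have "weight n (up_set D0) = weight n (up_set D)"
      using weight_le_weight_up_set(1)[OF D(1) nz(2)] max[OF D(1) nz(1)] by (simp add: w_def)
    moreover have "up_set D0 \<subseteq> {1..2 * n}"
      by (rule up_set_subset[OF matching_on_B_n[OF D0(1)]])
    ultimately have "up_set D0 = up_set D"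
      by (rule weight_le_weight_up_set(2)[OF D(1) nz(2)])
    then show False
      using inj_onD[OF bij_betw_imp_inj_on[OF bij_betw_up_set_B_n] _ D0(1) D(1)] D(2) by blast
  qed
  have "0 = linear_extension (state_coeff (up_set D0)) (\<Sum>D\<in>B_n n. Poly_Mapping.single D (c D))"
    using state_coeff_relations_ht[OF assms] by simp
  also have "\<dots> = (\<Sum>D\<in>B_n n. c D * state_coeff (up_set D0) D)"
    by (simp add: linear_extension_sum)
  also have "\<dots> = c D0 * state_coeff (up_set D0) D0 + (\<Sum>D\<in>B_n n - {D0}. c D * state_coeff (up_set D0) D)"
    using finite_B_n D0(1) by (rule sum.remove)
  also have "(\<Sum>D\<in>B_n n - {D0}. c D * state_coeff (up_set D0) D) = 0"
    using zero by (intro sum.neutral) auto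
  finally show False using D0 by (simp add: state_coeff_up_set)
qed

section \<open>Counting ballot sequences\<close>

text \<open>Prefixes up to \<open>N\<close> do not see the last point. The full prefix requires at
  least as many up as down points, which is the numerical condition.\<close>

lemma ballot_Suc:
  "ballot {1..Suc N} S \<longleftrightarrow> ballot {1..N} (S - {Suc N}) \<and> S \<subseteq> {1..Suc N} \<and> Suc N \<le> 2 * card S"
proof (cases "S \<subseteq> {1..Suc N}")
  case True
  then have fin: "finite S" using finite_subset by blast
  have low: "card {v \<in> {1..Suc N} - S. v \<le> x} = card {v \<in> {1..N} - (S - {Suc N}). v \<le> x}"
    "card {v \<in> S. v \<le> x} = card {v \<in> S - {Suc N}. v \<le> x}" if "x \<le> N" for x
  proof -
    have "{v \<in> {1..Suc N} - S. v \<le> x} = {v \<in> {1..N} - (S - {Suc N}). v \<le> x}"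
      "{v \<in> S. v \<le> x} = {v \<in> S - {Suc N}. v \<le> x}"
      using that by auto
    then show "card {v \<in> {1..Suc N} - S. v \<le> x} = card {v \<in> {1..N} - (S - {Suc N}). v \<le> x}"
      "card {v \<in> S. v \<le> x} = card {v \<in> S - {Suc N}. v \<le> x}" by simp_all
  qed
  have high: "(card {v \<in> {1..Suc N} - S. v \<le> x} \<le> card {v \<in> S. v \<le> x}) \<longleftrightarrow> Suc N \<le> 2 * card S"
    if "Suc N \<le> x" for x
  proof -
    have "{v \<in> {1..Suc N} - S. v \<le> x} = {1..Suc N} - S" "{v \<in> S. v \<le> x} = S"
      using that True by auto
    moreover have "card ({1..Suc N} - S) = Suc N - card S"
      using True fin by (simp add: card_Diff_subset)
    moreover have "card S \<le> Suc N" using card_mono[OF _ True] by simp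
    ultimately show ?thesis by auto
  qed
  \<comment> \<open>Beyond \<open>N\<close> the counts for \<open>S - {Suc N}\<close> keep their
    values at \<open>N\<close>, so its conditions reduce to \<open>x \<le> N\<close>.\<close>
  have high': "card {v \<in> {1..N} - (S - {Suc N}). v \<le> x} = card {v \<in> {1..N} - (S - {Suc N}). v \<le> N}"
    "card {v \<in> S - {Suc N}. v \<le> x} = card {v \<in> S - {Suc N}. v \<le> N}" if "Suc N \<le> x" for x
  proof -
    have "{v \<in> {1..N} - (S - {Suc N}). v \<le> x} = {v \<in> {1..N} - (S - {Suc N}). v \<le> N}"
      "{v \<in> S - {Suc N}. v \<le> x} = {v \<in> S - {Suc N}. v \<le> N}"
      using that True by auto
    then show "card {v \<in> {1..N} - (S - {Suc N}). v \<le> x} = card {v \<in> {1..N} - (S - {Suc N}). v \<le> N}"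
      "card {v \<in> S - {Suc N}. v \<le> x} = card {v \<in> S - {Suc N}. v \<le> N}" by simp_all
  qed
  have "(\<forall>x. card {v \<in> {1..Suc N} - S. v \<le> x} \<le> card {v \<in> S. v \<le> x}) \<longleftrightarrow>
     (\<forall>x. card {v \<in> {1..N} - (S - {Suc N}). v \<le> x} \<le> card {v \<in> S - {Suc N}. v \<le> x}) \<and> Suc N \<le> 2 * card S"
    (is "?L \<longleftrightarrow> ?R \<and> _")
  proof
    assume L: ?L
    then have le: "card {v \<in> {1..N} - (S - {Suc N}). v \<le> x} \<le> card {v \<in> S - {Suc N}. v \<le> x}" if "x \<le> N" for x
      using low[OF that] by metis
    have ?R
    proof
      fix x
      show "card {v \<in> {1..N} - (S - {Suc N}). v \<le> x} \<le> card {v \<in> S - {Suc N}. v \<le> x}"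
      proof (cases "x \<le> N")
        case False
        then show ?thesis using le[of N] high'[of x] by (simp only: not_le Suc_le_eq order_refl)
      qed (rule le)
    qed
    moreover have "Suc N \<le> 2 * card S" using L high[of "Suc N"] by blast
    ultimately show "?R \<and> Suc N \<le> 2 * card S" by blast
  next
    assume R: "?R \<and> Suc N \<le> 2 * card S"
    show ?L
    proof
      fix x
      show "card {v \<in> {1..Suc N} - S. v \<le> x} \<le> card {v \<in> S. v \<le> x}"
      proof (cases "x \<le> N")
        case True
        then show ?thesis using low[OF True] R by metis
      next
        case False
        then have "Suc N \<le> x" by simp
        from high[OF this] R show ?thesis by blast
      qed
    qed
  qed
  moreover have "S - {Suc N} \<subseteq> {1..N}" using True by fastforce
  ultimately show ?thesis using True by (simp only: ballot_def simp_thms conj_assoc)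
qed (simp add: ballot_def)

definition ballots :: "nat \<Rightarrow> nat \<Rightarrow> nat set set" where
  "ballots N u = {S. ballot {1..N} S \<and> card S = u}"

lemma finite_ballots: "finite (ballots N u)"
  by (rule finite_subset[of _ "Pow {1..N}"]) (auto simp: ballots_def ballot_def)

text \<open>Pascal's rule, by whether the last step goes up; the assumption is the condition on the
  full prefix.\<close>

lemma ballots_Suc:
  assumes "Suc N \<le> 2 * Suc u"
  shows "card (ballots (Suc N) (Suc u)) = card (ballots N u) + card (ballots N (Suc u))"
proof -
  have sub: "S \<subseteq> {1..N}" "finite S" "Suc N \<notin> S" if "ballot {1..N} S" for S
    using that finite_subset[of S "{1..N}"] by (auto simp: ballot_def)
  have "ballots (Suc N) (Suc u) = insert (Suc N) ` ballots N u \<union> ballots N (Suc u)"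
  proof (intro equalityI subsetI)
    fix S assume "S \<in> ballots (Suc N) (Suc u)"
    then have S: "ballot {1..N} (S - {Suc N})" "S \<subseteq> {1..Suc N}" "card S = Suc u"
      unfolding ballots_def ballot_Suc by auto
    show "S \<in> insert (Suc N) ` ballots N u \<union> ballots N (Suc u)"
    proof (cases "Suc N \<in> S")
      case True
      then have "S - {Suc N} \<in> ballots N u"
        using S(1,3) by (simp add: ballots_def card_Diff_singleton)
      then show ?thesis using insert_Diff[OF True] by (metis UnI1 imageI)
    next
      case False
      then show ?thesis using S by (simp add: ballots_def)
    qed
  next
    fix S assume "S \<in> insert (Suc N) ` ballots N u \<union> ballots N (Suc u)"
    then show "S \<in> ballots (Suc N) (Suc u)"
    proof
      assume "S \<in> insert (Suc N) ` ballots N u"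
      then obtain S' where S': "ballot {1..N} S'" "card S' = u" "S = insert (Suc N) S'"
        by (auto simp: ballots_def)
      note S'' = sub[OF S'(1)]
      have "S - {Suc N} = S'" "card S = Suc u" "S \<subseteq> {1..Suc N}" using S' S'' by auto
      then show ?thesis
        using S'(1) assms unfolding ballots_def ballot_Suc by simp
    next
      assume "S \<in> ballots N (Suc u)"
      then have S: "ballot {1..N} S" "card S = Suc u" by (auto simp: ballots_def)
      note S' = sub[OF S(1)]
      have "S - {Suc N} = S" "S \<subseteq> {1..Suc N}" using S' by auto
      then show ?thesis
        using S assms unfolding ballots_def ballot_Suc by simp
    qed
  qed
  moreover have "insert (Suc N) ` ballots N u \<inter> ballots N (Suc u) = {}"
    using sub(3) by (auto simp: ballots_def)
  moreover have "inj_on (insert (Suc N)) (ballots N u)"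
    using sub(3) by (intro inj_on_inverseI[of _ "\<lambda>S. S - {Suc N}"]) (simp add: ballots_def)
  ultimately show ?thesis
    by (simp add: card_Un_disjoint finite_ballots card_image)
qed

lemma ballots_empty:
  assumes "2 * u < N"
  shows "ballots N u = {}"
proof -
  obtain N' where N: "N = Suc N'" using assms by (cases N) auto
  show ?thesis using assms unfolding N ballots_def ballot_Suc by auto
qed

text \<open>The reflection-principle formula, with the negative term moved to the left to avoid
  subtraction of naturals. The bound reaches one step past the ballot range: at
  \<open>N = 2 * u + 1\<close> there are no ballots and the binomials agree, which anchors the
  recursion.\<close>

lemma card_ballots:
  "N \<le> 2 * u + 1 \<Longrightarrow> card (ballots N u) + (N choose Suc u) = (N choose u)"
proof (induction N arbitrary: u)
  case 0
  have "ballots 0 u = (if u = 0 then {{}} else {})"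
    by (auto simp: ballots_def ballot_def)
  then show ?case by simp
next
  case (Suc N)
  show ?case
  proof (cases "Suc N = 2 * u + 1")
    case True
    have "ballots (Suc N) u = {}" using True by (intro ballots_empty) simp
    moreover have "(Suc N choose Suc u) = (Suc N choose u)"
      using True binomial_symmetric[of u "Suc N"] by simp
    ultimately show ?thesis by simp
  next
    case False
    \<comment> \<open>For \<open>u = 0\<close> the bound would leave only \<open>Suc N = 1\<close>,
      the boundary case just excluded.\<close>
    then obtain v where u: "u = Suc v" using Suc.prems by (cases u) auto
    have "card (ballots (Suc N) (Suc v)) = card (ballots N v) + card (ballots N (Suc v))"
      using False Suc.prems u by (intro ballots_Suc) simp
    moreover have "card (ballots N v) + (N choose Suc v) = (N choose v)"
      using False Suc.prems u by (intro Suc.IH) simp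
    moreover have "card (ballots N (Suc v)) + (N choose Suc (Suc v)) = (N choose Suc v)"
      using Suc.prems u by (intro Suc.IH) simp
    ultimately show ?thesis by (simp add: u)
  qed
qed

text \<open>Absorption gives (n+k+1) C(2n, n+k+1) = (n-k) C(2n, n+k), and (n+k+1) - (n-k) =
  2k+1.\<close>

lemma card_ballots_rat:
  assumes "k \<le> n"
  shows "(of_nat (card (ballots (2 * n) (n + k))) :: rat) =
    of_nat (2 * k + 1) / of_nat (n + k + 1) * of_nat ((2 * n) choose (n + k))"
proof -
  have "Suc (n + k) * (2 * n choose Suc (n + k)) = (2 * n - (n + k)) * (2 * n choose (n + k))"
    by (metis binomial_absorb_comp binomial_absorption)
  also have "2 * n - (n + k) = n - k" by simp
  finally have eq: "(of_nat (Suc (n + k)) :: rat) * of_nat (2 * n choose Suc (n + k))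
      = (of_nat n - of_nat k) * of_nat (2 * n choose (n + k))"
    using assms by (metis of_nat_diff of_nat_mult)
  have card: "(of_nat (card (ballots (2 * n) (n + k))) :: rat)
      = of_nat (2 * n choose (n + k)) - of_nat (2 * n choose Suc (n + k))"
    using card_ballots[of "2 * n" "n + k"] assms by (simp flip: of_nat_add)
  have "of_nat (Suc (n + k)) * (of_nat (card (ballots (2 * n) (n + k))) :: rat)
     = of_nat (Suc (n + k)) * of_nat (2 * n choose (n + k)) - (of_nat n - of_nat k) * of_nat (2 * n choose (n + k))"
    unfolding card right_diff_distrib eq ..
  also have "\<dots> = of_nat (2 * k + 1) * of_nat (2 * n choose (n + k))"
    by (simp add: algebra_simps)
  finally have "of_nat (Suc (n + k)) * (of_nat (card (ballots (2 * n) (n + k))) :: rat)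
     = of_nat (2 * k + 1) * of_nat (2 * n choose (n + k))" .
  then show ?thesis by (simp add: field_simps del: of_nat_Suc)
qed

text \<open>The full prefix forces a ballot set to have at least \<open>n\<close> elements; size
  \<open>n + k\<close> means \<open>n\<close> left endpoints and \<open>k\<close> dotted
  arcs.\<close>

lemma card_B_n: "card (B_n n) = (\<Sum>k = 0..n. card (ballots (2 * n) (n + k)))"
proof -
  have "card (B_n n) = card {S. ballot {1..2 * n} S}"
    by (rule bij_betw_same_card[OF bij_betw_up_set_B_n])
  also have "{S. ballot {1..2 * n} S} = (\<Union>k\<in>{0..n}. ballots (2 * n) (n + k))"
  proof (intro equalityI subsetI)
    fix S assume "S \<in> {S. ballot {1..2 * n} S}"
    then have S: "ballot {1..2 * n} S" by simp
    then have "card S \<le> card {1..2 * n}" by (intro card_mono) (auto simp: ballot_def)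
    moreover have "\<not> 2 * card S < 2 * n"
      using ballots_empty[of "card S" "2 * n"] S by (auto simp: ballots_def)
    ultimately have "card S = n + (card S - n)" "card S - n \<in> {0..n}" by auto
    with S show "S \<in> (\<Union>k\<in>{0..n}. ballots (2 * n) (n + k))"
      unfolding ballots_def by blast
  qed (auto simp: ballots_def)
  also have "card \<dots> = (\<Sum>k = 0..n. card (ballots (2 * n) (n + k)))"
    by (intro card_UN_disjoint) (auto simp: finite_ballots, auto simp: ballots_def)
  finally show ?thesis .
qed

section \<open>Spanning\<close>

definition dot_sum :: "(arc \<Rightarrow> nat \<Rightarrow> nat) \<Rightarrow> diagram \<Rightarrow> nat" where
  "dot_sum g D = (\<Sum>e\<in>dom D. g e (the (D e)))"

lemma dot_sum_update:
  assumes "finite (dom D)" "e \<notin> dom D"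
  shows "dot_sum g (D(e \<mapsto> m)) = g e m + dot_sum g D"
proof -
  have "(\<Sum>e'\<in>dom D. g e' (the ((D(e \<mapsto> m)) e'))) = dot_sum g D"
    unfolding dot_sum_def using assms(2) by (intro sum.cong refl) auto
  with assms show ?thesis by (simp add: dot_sum_def)
qed

text \<open>A measure of nesting that ignores dots: replacing \<open>(a, d)\<close>,
  \<open>(b, c)\<close> by \<open>(a, b)\<close>, \<open>(c, d)\<close> lowers it by 2(c -
  b).\<close>

definition total_length :: "diagram \<Rightarrow> nat" where
  "total_length = dot_sum (\<lambda>e _. snd e - fst e)"

text \<open>A dot is cheaper on a longer arc, so moving a dot outwards decreases the cost.\<close>

definition dot_cost :: "nat \<Rightarrow> diagram \<Rightarrow> nat" where
  "dot_cost n = dot_sum (\<lambda>e m. m * (2 * n - (snd e - fst e)))"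

lemma ex_innermost_enclosing_arc:
  fixes A :: "arc set"
  assumes "finite A" "(x, y) \<in> A" "x < b" "c < y"
  shows "\<exists>a d. (a, d) \<in> A \<and> a < b \<and> c < d \<and> (\<forall>x y. (x, y) \<in> A \<longrightarrow> x < b \<longrightarrow> c < y \<longrightarrow> x \<le> a)"
proof -
  let ?E = "{e \<in> A. fst e < b \<and> c < snd e}"
  have "finite (fst ` ?E)" "fst ` ?E \<noteq> {}" using assms by auto
  then have "Max (fst ` ?E) \<in> fst ` ?E" by (rule Max_in)
  then obtain a d where ad: "(a, d) \<in> A" "a < b" "c < d" "a = Max (fst ` ?E)" by auto
  have "x \<le> a" if "(x, y) \<in> A" "x < b" "c < y" for x y
    unfolding ad(4) using that \<open>finite (fst ` ?E)\<close> by (intro Max_ge) force+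
  with ad show ?thesis by blast
qed

text \<open>An arc lying between \<open>(a, d)\<close> and \<open>(b, c)\<close> would cross both
  new arcs; \<open>inner\<close> excludes it. Any other arc crossing a new arc would already cross
  an old one.\<close>

lemma matching_on_unnest:
  assumes M: "matching_on V A" and ad: "(a, d) \<in> A" and bc: "(b, c) \<in> A" and "a < b" "c < d"
    and inner: "\<And>x y. (x, y) \<in> A \<Longrightarrow> x < b \<Longrightarrow> c < y \<Longrightarrow> x \<le> a"
  shows "matching_on V (insert (a, b) (insert (c, d) (A - {(a, d), (b, c)})))"
proof -
  have "b < c" using matching_onD[OF M bc] by simp
  have in_V: "a \<in> V" "b \<in> V" "c \<in> V" "d \<in> V" using matching_onD[OF M ad] matching_onD[OF M bc] by auto
  let ?A = "A - {(a, d)} - {(b, c)}" and ?V = "V - {a, d} - {b, c}"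
  have M1: "matching_on (V - {a, d}) (A - {(a, d)})" by (rule matching_on_remove[OF M ad])
  have M2: "matching_on ?V ?A"
    using bc \<open>a < b\<close> by (intro matching_on_remove[OF M1]) auto
  have outside: "\<not> (x < c \<and> c < y \<and> y < d) \<and> \<not> (c < x \<and> x < d \<and> d < y)"
     "\<not> (x < a \<and> a < y \<and> y < b) \<and> \<not> (a < x \<and> x < b \<and> b < y)"
    if xy: "(x, y) \<in> ?A" for x y
  proof -
    have A: "(x, y) \<in> A" using xy by simp
    have ne: "x \<noteq> a" "x \<noteq> b" "x \<noteq> c" "x \<noteq> d" "y \<noteq> a" "y \<noteq> b" "y \<noteq> c" "y \<noteq> d"
      using matching_onD[OF M2 xy] by auto
    have "x < y" using matching_onD[OF M A] by simp
    note nc = matching_on_noncrossing[OF M A ad] matching_on_noncrossing[OF M ad A]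
      matching_on_noncrossing[OF M A bc] matching_on_noncrossing[OF M bc A] inner[OF A]
    have "False" if *: "x < c" "c < y" "y < d"
    proof (cases "x < b")
      case True
      then have "x < a" using nc(5)[OF _ *(2)] ne(1) by simp
      then show False using nc(1) * \<open>a < b\<close> \<open>b < c\<close> by simp
    next
      case False
      then show False using nc(4) * ne(2) by simp
    qed
    moreover have "False" if *: "c < x" "x < d" "d < y"
      using nc(2) * \<open>a < b\<close> \<open>b < c\<close> by simp
    moreover have "False" if *: "x < a" "a < y" "y < b"
      using nc(1)[OF *(1,2)] * \<open>b < c\<close> \<open>c < d\<close> by simp
    moreover have "False" if *: "a < x" "x < b" "b < y"
      using nc(3)[OF *(2,3)] nc(5) * ne(7) by simp
    ultimately show "\<not> (x < c \<and> c < y \<and> y < d) \<and> \<not> (c < x \<and> x < d \<and> d < y)"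
     "\<not> (x < a \<and> a < y \<and> y < b) \<and> \<not> (a < x \<and> x < b \<and> b < y)"
      by blast+
  qed
  have M3: "matching_on (insert c (insert d ?V)) (insert (c, d) ?A)"
    using outside(1) by (intro matching_on_insert[OF M2 \<open>c < d\<close>]) auto
  have "matching_on (insert a (insert b (insert c (insert d ?V)))) (insert (a, b) (insert (c, d) ?A))"
  proof (rule matching_on_insert[OF M3 \<open>a < b\<close>])
    fix x y assume "(x, y) \<in> insert (c, d) ?A"
    then consider "x = c" "y = d" | "(x, y) \<in> ?A" by blast
    then show "\<not> (x < a \<and> a < y \<and> y < b) \<and> \<not> (a < x \<and> x < b \<and> b < y)"
    proof cases
      case 1
      then show ?thesis using \<open>a < b\<close> \<open>b < c\<close> by simp
    next
      case 2
      then show ?thesis by (rule outside(2))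
    qed
  qed (use \<open>a < b\<close> \<open>b < c\<close> \<open>c < d\<close> in auto)
  moreover have "insert a (insert b (insert c (insert d ?V))) = V" using in_V by auto
  moreover have "?A = A - {(a, d), (b, c)}" by auto
  ultimately show ?thesis by simp
qed

text \<open>The induction is lexicographic in \<open>total_length\<close> and
  \<open>dot_cost\<close>. Dot reduction keeps the matching and lowers the cost; pushing a dot
  outwards yields shorter matchings, and the same matching with cheaper dots.\<close>

lemma spanned_by_B_n:
  assumes "D \<in> diagrams n"
  shows "free_module_quotient.spanned (diagrams n)
    (dot_relations n \<union> type_I_relations n \<union> type_II_relations n) (B_n n) (Poly_Mapping.single D 1)"
proof -
  interpret free_module_quotient "diagrams n" "dot_relations n \<union> type_I_relations n \<union> type_II_relations n"
    using generators_in_carrier by unfold_locales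
  have "wf (measures [total_length, dot_cost n])" by simp
  then have "D \<in> diagrams n \<longrightarrow> spanned (B_n n) (Poly_Mapping.single D 1)"
  proof (induction D rule: wf_induct_rule)
    case (less D)
    show ?case
    proof
      assume D: "D \<in> diagrams n"
      have M: "matching_on {1..2 * n} (dom D)"
        using D unfolding diagrams_def crossingless_matching_eq_matching_on by blast
      have fin: "finite (dom D)" by (rule diagrams_finite_dom[OF D])
      have IH: "spanned (B_n n) (Poly_Mapping.single D' x)"
        if "D' \<in> diagrams n"
          "total_length D' < total_length D \<or> total_length D' = total_length D \<and> dot_cost n D' < dot_cost n D"
        for D' x
        by (rule spanned_single) (use less that in auto)
      \<comment> \<open>Every dot has positive cost, so removing dots is strict progress.\<close>
      have cost_pos: "snd e - fst e < 2 * n" if "e \<in> dom D" for e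
        using matching_onD[OF M, of "fst e" "snd e"] that by auto
      consider (multiple) e where "e \<in> dom D" "2 \<le> the (D e)"
        | (inner) e where "e \<in> dom D" "the (D e) = 1" "\<not> outer (dom D) e" "\<forall>e\<in>dom D. the (D e) \<le> 1"
        | (basis) "\<forall>e\<in>dom D. the (D e) \<le> 1" "\<forall>e\<in>dom D. 0 < the (D e) \<longrightarrow> outer (dom D) e"
      proof (cases "\<forall>e\<in>dom D. the (D e) \<le> 1")
        case True
        show ?thesis
        proof (cases "\<forall>e\<in>dom D. 0 < the (D e) \<longrightarrow> outer (dom D) e")
          case False
          then obtain e where e: "e \<in> dom D" "0 < the (D e)" "\<not> outer (dom D) e" by blast
          then have "the (D e) = 1" using True by (metis One_nat_def le_antisym Suc_leI)
          then show ?thesis using inner e True by blast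
        qed (use basis True in blast)
      next
        case False
        then obtain e where "e \<in> dom D" "\<not> the (D e) \<le> 1" by blast
        then show ?thesis using multiple[of e] by simp
      qed
      then show "spanned (B_n n) (Poly_Mapping.single D 1)"
      proof cases
        case multiple
        define m where "m = the (D e) - 2"
        have De: "D e = Some (m + 2)" using multiple by (auto simp: m_def)
        let ?D = "D |` (- {e})"
        \<comment> \<open>The arc is taken out and put back because \<open>dot_sum_update\<close>
          expects an arc outside the domain.\<close>
        have upd: "D(e \<mapsto> i) = ?D(e \<mapsto> i)" for i by (auto simp: restrict_map_def fun_eq_iff)
        have D_eq: "D = D(e \<mapsto> m + 2)" using De by (simp add: fun_upd_idem)
        have fin': "finite (dom ?D)" "e \<notin> dom ?D" using fin by auto
        have dia: "D(e \<mapsto> i) \<in> diagrams n" for i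
          using D multiple(1) by (simp add: diagrams_def insert_absorb)
        have tl: "total_length (D(e \<mapsto> i)) = total_length D" for i
          by (subst (2) D_eq) (simp only: upd total_length_def dot_sum_update[OF fin'])
        have dc: "dot_cost n (D(e \<mapsto> i)) < dot_cost n D" if "i < m + 2" for i
        proof -
          have "i * (2 * n - (snd e - fst e)) < (m + 2) * (2 * n - (snd e - fst e))"
            using that cost_pos[OF multiple(1)] by (intro mult_strict_right_mono) auto
          then show ?thesis
            by (subst (2) D_eq) (simp only: upd dot_cost_def dot_sum_update[OF fin'] add_less_cancel_right)
        qed
        have "Poly_Mapping.single (D(e \<mapsto> m + 2)) 1 - (Poly_Mapping.single (D(e \<mapsto> m + 1)) var_h
            + Poly_Mapping.single (D(e \<mapsto> m)) var_t) \<in> dot_relations n"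
          unfolding dot_relations_def using dia by blast
        then have "Poly_Mapping.single D 1 - (Poly_Mapping.single (D(e \<mapsto> m + 1)) var_h
            + Poly_Mapping.single (D(e \<mapsto> m)) var_t) \<in> N"
          using N_generator D_eq by auto
        moreover have "spanned (B_n n) (Poly_Mapping.single (D(e \<mapsto> m + 1)) var_h
            + Poly_Mapping.single (D(e \<mapsto> m)) var_t)"
          using dia tl dc by (intro spanned_add IH) simp_all
        ultimately show ?thesis by (rule spanned_cong[rotated])
      next
        case inner
        obtain b c where e: "e = (b, c)" by (cases e)
        obtain x y where "(x, y) \<in> dom D" "x < b" "c < y"
          using inner(3) unfolding e outer_iff by (metis fst_conv snd_conv prod.collapse)
        from ex_innermost_enclosing_arc[OF fin this]
        obtain a d where ad: "(a, d) \<in> dom D" "a < b" "c < d"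
          and max: "\<And>x y. (x, y) \<in> dom D \<Longrightarrow> x < b \<Longrightarrow> c < y \<Longrightarrow> x \<le> a" by blast
        have bc: "(b, c) \<in> dom D" "D (b, c) = Some 1" using inner(1,2) e by auto
        have "b < c" "d \<le> 2 * n" "1 \<le> a" using matching_onD[OF M bc(1)] matching_onD[OF M ad(1)] by auto
        define i where "i = the (D (a, d))"
        have i: "D (a, d) = Some i" "i = 0 \<or> i = 1"
          using ad(1) inner(4) by (auto simp: i_def le_Suc_eq)
        define D0 where "D0 = D |` (- {(a, d), (b, c)})"
        have dom0: "dom D0 = dom D - {(a, d), (b, c)}" by (auto simp: D0_def)
        have fin0: "finite (dom D0)" using fin by (simp add: dom0)
        define P where "P j k = D0((a, b) \<mapsto> j, (c, d) \<mapsto> k)" for j k :: nat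
        define Q where "Q j k = D0((a, d) \<mapsto> j, (b, c) \<mapsto> k)" for j k :: nat
        have D_eq: "D = Q i 1"
          using i(1) bc(2) by (auto simp: Q_def D0_def restrict_map_def fun_eq_iff)
        have "dom (Q j k) = dom D" for j k using ad(1) bc(1) by (auto simp: Q_def dom0)
        then have Q: "Q j k \<in> diagrams n" for j k using D by (simp add: diagrams_def)
        have "dom (P j k) = insert (a, b) (insert (c, d) (dom D - {(a, d), (b, c)}))" for j k
          by (auto simp: P_def dom0)
        then have P: "P j k \<in> diagrams n" for j k
          using matching_on_unnest[OF M ad(1) bc(1) ad(2,3) max]
          by (simp add: diagrams_def crossingless_matching_eq_matching_on)
        have notin: "(a, b) \<notin> dom D0" "(c, d) \<notin> dom (D0((a, b) \<mapsto> j))"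
          "(a, d) \<notin> dom D0" "(b, c) \<notin> dom (D0((a, d) \<mapsto> j))" for j
          using matching_on_unique[OF M _ ad(1), of "(a, b)" a]
            matching_on_unique[OF M _ ad(1), of "(c, d)" d] \<open>b < c\<close> ad(2,3)
          by (auto simp: dom0)
        have sum_P: "dot_sum g (P j k) = g (c, d) k + (g (a, b) j + dot_sum g D0)" for g j k
          unfolding P_def using fin0 notin by (simp add: dot_sum_update del: fun_upd_apply)
        have sum_Q: "dot_sum g (Q j k) = g (b, c) k + (g (a, d) j + dot_sum g D0)" for g j k
          unfolding Q_def using fin0 notin by (simp add: dot_sum_update del: fun_upd_apply)
        have spanned_P: "spanned (B_n n) (Poly_Mapping.single (P j k) x)" for j k x
          using \<open>b < c\<close> ad(2,3) by (intro IH P disjI1) (simp add: D_eq total_length_def sum_P sum_Q)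
        \<comment> \<open>The inner arc loses its dot. If \<open>i = 0\<close>, the outer arc gains
          at most one dot, which is cheaper there; if \<open>i = 1\<close>, it gains none.\<close>
        have spanned_Q: "spanned (B_n n) (Poly_Mapping.single (Q j 0) x)" if "j \<le> 1" for j x
        proof -
          have "2 * n - (d - a) < 2 * n - (c - b)" using \<open>b < c\<close> ad(2,3) \<open>d \<le> 2 * n\<close> \<open>1 \<le> a\<close> by linarith
          then have "dot_cost n (Q j 0) < dot_cost n D"
            using i(2) that by (auto simp: D_eq dot_cost_def sum_Q le_Suc_eq)
          moreover have "total_length (Q j 0) = total_length D"
            by (simp add: D_eq total_length_def sum_Q)
          ultimately show ?thesis by (intro IH Q) simp
        qed
        have diag: "a < b" "b < c" "c < d" "P 0 0 \<in> diagrams n" "Q 0 0 \<in> diagrams n"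
          using ad \<open>b < c\<close> P Q by simp_all
        show ?thesis
        \<comment> \<open>An undotted enclosing arc receives the dot by type I; a dotted one cannot
          take a second, and type II trades both dots for none.\<close>
        proof (cases "i = 0")
          case True
          let ?r = "(Poly_Mapping.single (P 1 0) 1 + Poly_Mapping.single (P 0 1) 1 - Poly_Mapping.single (P 0 0) var_h)
            - (Poly_Mapping.single (Q 1 0) 1 + Poly_Mapping.single (Q 0 1) 1 - Poly_Mapping.single (Q 0 0) var_h)"
          let ?g = "Poly_Mapping.single (P 1 0) 1 + Poly_Mapping.single (P 0 1) 1 - Poly_Mapping.single (P 0 0) var_h
            - Poly_Mapping.single (Q 1 0) 1 + Poly_Mapping.single (Q 0 0) var_h"
          have "?r \<in> type_I_relations n"
            unfolding type_I_relations_def mem_Collect_eq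
            by (rule exI[of _ D0], rule exI[of _ a], rule exI[of _ b], rule exI[of _ c], rule exI[of _ d],
                rule exI[of _ "0::nat"], rule exI[of _ "0::nat"], 
                rule exI[of _ "0::nat"], rule exI[of _ "0::nat"])
              (use diag in \<open>simp only: Let_def P_def Q_def add_0_left simp_thms\<close>)
          \<comment> \<open>The diagram \<open>D\<close> is \<open>Q 0 1\<close>, which has
            coefficient -1 in \<open>?r\<close>; negation isolates it.\<close>
          then have "- ?r \<in> N" by (intro N_minus N_generator) simp
          also have "- ?r = Poly_Mapping.single D 1 - ?g" unfolding D_eq True by simp
          finally have "Poly_Mapping.single D 1 - ?g \<in> N" .
          moreover have "spanned (B_n n) ?g"
            by (intro spanned_add spanned_diff spanned_P spanned_Q) simp_all
          ultimately show ?thesis by (rule spanned_cong[rotated])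
        next
          case False
          then have i1: "i = 1" using i(2) by simp
          let ?r = "(Poly_Mapping.single (P 1 1) 1 + Poly_Mapping.single (P 0 0) var_t)
            - (Poly_Mapping.single (Q 1 1) 1 + Poly_Mapping.single (Q 0 0) var_t)"
          let ?g = "Poly_Mapping.single (P 1 1) 1 + Poly_Mapping.single (P 0 0) var_t
            - Poly_Mapping.single (Q 0 0) var_t"
          have "?r \<in> type_II_relations n"
            unfolding type_II_relations_def mem_Collect_eq
            by (rule exI[of _ D0], rule exI[of _ a], rule exI[of _ b], rule exI[of _ c], rule exI[of _ d],
                rule exI[of _ "0::nat"], rule exI[of _ "0::nat"], 
                rule exI[of _ "0::nat"], rule exI[of _ "0::nat"])
              (use diag in \<open>simp only: Let_def P_def Q_def add_0_left simp_thms\<close>)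
          then have "- ?r \<in> N" by (intro N_minus N_generator) simp
          also have "- ?r = Poly_Mapping.single D 1 - ?g" unfolding D_eq i1 by simp
          finally have "Poly_Mapping.single D 1 - ?g \<in> N" .
          moreover have "spanned (B_n n) ?g"
            by (intro spanned_add spanned_diff spanned_P spanned_Q) simp_all
          ultimately show ?thesis by (rule spanned_cong[rotated])
        qed
      next
        case basis
        then have "D \<in> B_n n" using M unfolding B_n_eq outer_dotted_def by blast
        then show ?thesis using finite_B_n by (rule spanned_base[rotated])
      qed
    qed
  qed
  with assms show ?thesis by blast
qed

section \<open>Basis and rank of the quotient module\<close>

theorem theorem5p3p1:
  fixes n :: nat
  shows "(of_nat (free_rank Z_ht (R_ht n)) :: rat) =
           (\<Sum>k = 0..n. of_nat (2 * k + 1) / of_nat (n + k + 1) * of_nat ((2 * n) choose (n + k)))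
         \<and> inj_on (diagram_class n) (B_n n)
         \<and> module_basis Z_ht (R_ht n) (diagram_class n ` B_n n)"
proof -
  interpret free_module_quotient "diagrams n" "dot_relations n \<union> type_I_relations n \<union> type_II_relations n"
    using generators_in_carrier by unfold_locales
  have N: "N = relations_ht n" by (simp add: N_def relations_ht_def)
  have cls: "(\<lambda>D. cls (Poly_Mapping.single D 1)) = diagram_class n"
    by (simp add: fun_eq_iff cls_def diagram_class_def N)
  have sub: "B_n n \<subseteq> diagrams n" by (auto simp: B_n_def B_nk_def)
  note basis = basis_of_quotient[OF finite_B_n sub spanned_by_B_n B_n_independent, unfolded N cls]
  have inj: "inj_on (diagram_class n) (B_n n)" by (rule basis(1))
  have mb: "module_basis Z_ht (R_ht n) (diagram_class n ` B_n n)"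
    unfolding R_ht_def by (rule basis(2))
  have "free_rank Z_ht (R_ht n) = card (diagram_class n ` B_n n)"
    using finite_B_n by (intro free_rank_eq_card[OF module_R_ht mb]) simp
  also have "\<dots> = card (B_n n)" by (rule card_image[OF inj])
  finally have "(of_nat (free_rank Z_ht (R_ht n)) :: rat) =
     (\<Sum>k = 0..n. of_nat (card (ballots (2 * n) (n + k))))"
    by (simp add: card_B_n)
  also have "\<dots> = (\<Sum>k = 0..n. of_nat (2 * k + 1) / of_nat (n + k + 1) * of_nat ((2 * n) choose (n + k)))"
    by (intro sum.cong refl card_ballots_rat) simp
  finally show ?thesis using inj mb by blast
qed

end
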